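(* (i) Let $\beta\leq0$ and $\nu>-\frac{1}{2}$. Then, for all $x\geq0$, $$\frac{\mathrm{e}^{-\beta x}I_{\nu}(x)}{x^\nu}\int_x^\infty \mathrm{e}^{\beta t}t^{\nu+1}K_{\nu}(t)\,\mathrm{d}t< 1, \qquad \frac{\mathrm{e}^{-\beta x}I_{\nu+1}(x)}{x^\nu}\int_x^\infty \mathrm{e}^{\beta t}t^{\nu+1}K_{\nu}(t)\,\mathrm{d}t< \frac{1}{2}.$$ (ii) Let $\beta\leq0$ and $\nu>-\frac{1}{2}$. Then, for all $x\geq0$, $$\frac{\mathrm{e}^{-\beta x}I_{\nu}(x)}{x^{\nu-1}}\int_x^\infty \mathrm{e}^{\beta t}t^{\nu}K_{\nu}(t)\,\mathrm{d}t< 1, \qquad \frac{\mathrm{e}^{-\beta x}I_{\nu+1}(x)}{x^{\nu-1}}\int_x^\infty \mathrm{e}^{\beta t}t^{\nu}K_{\nu}(t)\,\mathrm{d}t< \frac{1}{2}.$$ (iii) Let $0< \beta <1$ and $\nu>-\frac{1}{2}$. Then, for all $x\geq0$, $$\frac{\mathrm{e}^{-\beta x}I_{\nu}(x)}{x^\nu}\int_x^\infty \mathrm{e}^{\beta t}t^{\nu+1}K_{\nu}(t)\,\mathrm{d}t< 1+\frac{2\sqrt{\pi}\beta\Gamma(\nu+\frac{3}{2})}{(1-\beta^2)^{\nu+\frac{3}{2}}\Gamma(\nu+1)},$$ $$\frac{\mathrm{e}^{-\beta x}I_{\nu+1}(x)}{x^\nu}\int_x^\infty \mathrm{e}^{\beta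 t}t^{\nu+1}K_{\nu}(t)\,\mathrm{d}t< \frac{1}{2}+\frac{\sqrt{\pi}\beta\Gamma(\nu+\frac{3}{2})}{(1-\beta^2)^{\nu+\frac{3}{2}}\Gamma(\nu+1)}.$$ (iv) Let $0< \beta <1$ and $\nu>-\frac{1}{2}$. Then, for all $x\geq0$, $$\frac{\mathrm{e}^{-\beta x}I_{\nu}(x)}{x^{\nu-1}}\int_x^\infty \mathrm{e}^{\beta t}t^{\nu}K_{\nu}(t)\,\mathrm{d}t< N_{\nu,\beta}, \qquad \frac{\mathrm{e}^{-\beta x}I_{\nu+1}(x)}{x^{\nu-1}}\int_x^\infty \mathrm{e}^{\beta t}t^{\nu}K_{\nu}(t)\,\mathrm{d}t< N_{\nu,\beta},$$ where $$N_{\nu,\beta}= \begin{cases}\displaystyle \frac{1}{2(1-\beta)}, & \nu\leq\tfrac{1}{2}, \\[2mm] \displaystyle\frac{\sqrt{\pi}\,\Gamma(\nu+\frac{1}{2})}{(1-\beta^2)^{\nu+\frac{1}{2}}\Gamma(\nu)}, & \nu>\tfrac{1}{2}. \end{cases}$$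
   Context: $I_\nu$ and $K_\nu$ denote the modified Bessel functions of the first and second kind of real order $\nu$, and $\Gamma$ is the gamma function. At $x=0$ each expression on a left-hand side is understood as its limit as $x\downarrow0$.
   Formalization: In the first inequality of (i), for β = 0 and x = 0 the bound is "≤ 1" instead of "< 1", because for β = 0 the left side equals x I_ν(x) K_{ν+1}(x), whose limit as x↓0 is exactly 1. *)

theory Defs
  imports "HOL-Analysis.Analysis"
begin

text \<open>
  Both Bessel functions are meant for real order and positive argument only. In \<open>bessel_I\<close>,
  \<open>rGamma\<close> is the entire function \<open>1/\<Gamma>\<close>, so the series is the usual one for every real order,
  negative integers included.
\<close>

definition bessel_I :: "real \<Rightarrow> real \<Rightarrow> real" where
  "bessel_I \<nu> x =
     (\<Sum>k. rGamma (\<nu> + real k + 1) / fact k * (x / 2) powr (\<nu> + 2 * real k))"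

definition bessel_K :: "real \<Rightarrow> real \<Rightarrow> real" where
  "bessel_K \<nu> x = (LBINT u:{0<..}. exp (- x * cosh u) * cosh (\<nu> * u))"

text \<open>
  \<open>has_value_at f x y\<close>: the expression \<open>f\<close> has the value \<open>y\<close> at \<open>x \<ge> 0\<close>, where the value at
  \<open>0\<close> is the limit from the right. In particular \<open>has_value_at f 0 y\<close> asserts that this limit
  exists.
\<close>

definition has_value_at :: "(real \<Rightarrow> real) \<Rightarrow> real \<Rightarrow> real \<Rightarrow> bool" where
  "has_value_at f x y \<longleftrightarrow> (if x = 0 then (f \<longlongrightarrow> y) (at_right 0) else f x = y)"

definition bessel_N :: "real \<Rightarrow> real \<Rightarrow> real" where
  "bessel_N \<nu> \<beta> =
     (if \<nu> \<le> 1/2 then 1 / (2 * (1 - \<beta>))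
      else sqrt pi * Gamma (\<nu> + 1/2) / ((1 - \<beta>\<^sup>2) powr (\<nu> + 1/2) * Gamma \<nu>))"

end

theory Submission
  imports Defs "HOL-Probability.Distributions"
begin

text \<open>
Write \<open>a = \<nu> + 1/2 > 0\<close>, \<open>r = I\<^bsub>\<nu>+1\<^esub> / I\<^bsub>\<nu>\<^esub>\<close> and
\<open>P(x) = exp (-\<beta>x) I\<^bsub>\<nu>\<^esub>(x) x\<^bsup>-\<nu>\<^esup> \<integral>\<^bsub>x\<^esub>\<^bsup>\<infinity>\<^esup> exp (\<beta>t) t\<^bsup>\<nu>+1\<^esup> K\<^bsub>\<nu>\<^esub>(t) dt\<close>.
Since \<open>x\<^bsup>\<nu>+1\<^esup> K\<^bsub>\<nu>+1\<^esub>\<close> has derivative \<open>- x\<^bsup>\<nu>+1\<^esup> K\<^bsub>\<nu>\<^esub>\<close>, integration by parts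
(\<open>scaled_integral_by_parts\<close>) turns \<open>P\<close> into the product \<open>x I\<^bsub>\<nu>\<^esub> K\<^bsub>\<nu>+1\<^esub>\<close> plus \<open>\<beta>\<close> times a
positive remainder, the same expression with the kernel \<open>t\<^bsup>\<nu>+1\<^esup> K\<^bsub>\<nu>+1\<^esub>\<close>. The product is below 1
by the Wronskian identity \<open>x (I\<^bsub>\<nu>\<^esub> K\<^bsub>\<nu>+1\<^esub> + I\<^bsub>\<nu>+1\<^esub> K\<^bsub>\<nu>\<^esub>) = 1\<close>, and for \<open>\<beta> \<le> 0\<close> the remainder
only helps. Multiplying by \<open>r\<close> gives the expressions with \<open>I\<^bsub>\<nu>+1\<^esub>\<close>; their leading term
\<open>x I\<^bsub>\<nu>+1\<^esub> K\<^bsub>\<nu>+1\<^esub>\<close> is below 1/2 because \<open>x I\<^bsub>\<mu>\<^esub> K\<^bsub>\<mu>\<^esub> < 1/2\<close> for \<open>\<mu> \<ge> 1/2\<close>. For \<open>\<beta> \<le> 0\<close> the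
versions with the weight \<open>t\<^bsup>\<nu>\<^esup>\<close> follow from \<open>t\<^bsup>\<nu>\<^esup> \<le> t\<^bsup>\<nu>+1\<^esup> / x\<close>.

For \<open>0 < \<beta> < 1\<close> the remainder is controlled by a monotonicity: with
\<open>h(t) = exp (\<beta>t) t\<^bsup>\<mu>\<^esup> K\<^bsub>\<mu>\<^esub>(t)\<close> and \<open>\<mu> > 1/2\<close>, the quotient of the tail integral of \<open>h\<close> by \<open>h\<close> is
decreasing, because the logarithmic derivative \<open>\<beta> - K\<^bsub>\<mu>-1\<^esub>/K\<^bsub>\<mu>\<^esub>\<close> of \<open>h\<close> is. It is therefore bounded
by its value at 0 (\<open>exp_bessel_K_tail_le\<close>). The integral of \<open>h\<close> over the half line that occurs
there is less than that over the whole line, which is a Gaussian integral followed by a Gamma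
integral (\<open>bessel_K_laplace_less\<close>) and produces the constants of the theorem. The remainder
calls for \<open>\<mu> = \<nu> + 1\<close>; with \<open>\<mu> = \<nu>\<close> the same bound and \<open>x I\<^bsub>\<nu>\<^esub> K\<^bsub>\<nu>\<^esub> < 1/2\<close> give the last part for
\<open>\<nu> > 1/2\<close>.

The case \<open>-1/2 < \<nu> \<le> 1/2\<close> of the last part is of a different nature, since there \<open>x I\<^bsub>\<nu>\<^esub> K\<^bsub>\<nu>\<^esub>\<close>
may exceed 1/2. Here
\<open>G = x\<^bsup>\<nu>-1\<^esup> exp (\<beta>x) / (2 (1-\<beta>) I\<^bsub>\<nu>\<^esub>) - \<integral>\<^bsub>x\<^esub>\<^bsup>\<infinity>\<^esup> exp (\<beta>t) t\<^bsup>\<nu>\<^esup> K\<^bsub>\<nu>\<^esub>(t) dt\<close> is shown to be decreasing,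
hence positive. The sign of its derivative is that of
\<open>2 (1-\<beta>) x I\<^bsub>\<nu>\<^esub> K\<^bsub>\<nu>\<^esub> - (1/x + r - \<beta>)\<close>, which is affine in \<open>\<beta>\<close>. So it suffices to have
\<open>1/x + r > 1\<close> and \<open>2 x I\<^bsub>\<nu>\<^esub> K\<^bsub>\<nu>\<^esub> < 1/x + r\<close>, and both come from the bound
\<open>r > 1 - (2\<nu>+2)/(3x)\<close> (\<open>bessel_I_ratio_gt_small_order\<close>).

All estimates on \<open>r\<close> and on \<open>x I\<^bsub>\<nu>\<^esub> K\<^bsub>\<nu>\<^esub>\<close> are comparison arguments. The ratio solves the Riccati
equation \<open>r' = 1 - r\<^sup>2 - 2ar/x\<close>, so its bounds are subsolutions and supersolutions that start on
the correct side of it. The product \<open>w = x I\<^bsub>\<nu>\<^esub> K\<^bsub>\<nu>\<^esub>\<close> solves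
\<open>w' = 2 (r + a/x) w - 1\<close>, whose solutions are unstable: if one of its upper bounds failed anywhere,
\<open>w\<close> would be unbounded, whereas \<open>w \<le> 1\<close>.
\<close>

section \<open>Tail integrals and linear differential inequalities\<close>

lemma tail_integral_at_top:
  fixes f :: "real \<Rightarrow> real"
  assumes "set_integrable lborel {0<..} f"
  shows "((\<lambda>x. LBINT t:{x<..}. f t) \<longlongrightarrow> 0) at_top"
proof (rule tendsto_at_topI_sequentially)
  fix X :: "nat \<Rightarrow> real" assume X: "filterlim X at_top sequentially"
  have "((\<lambda>n. LINT t|lborel. indicator {X n<..} t *\<^sub>R indicator {0<..} t *\<^sub>R f t)
          \<longlonglongrightarrow> (LINT t::real|lborel. (0::real)))"
  proof (rule integral_dominated_convergence[where w = "\<lambda>t. norm (indicator {0<..} t *\<^sub>R f t)"])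
    show "AE t in lborel. (\<lambda>n. indicator {X n<..} t *\<^sub>R indicator {0<..} t *\<^sub>R f t) \<longlonglongrightarrow> 0"
    proof (rule AE_I2)
      fix t :: real
      have "eventually (\<lambda>n. t < X n) sequentially"
        using X by (simp add: filterlim_at_top_dense)
      then show "(\<lambda>n. indicator {X n<..} t *\<^sub>R indicator {0<..} t *\<^sub>R f t) \<longlonglongrightarrow> 0"
        by (rule tendsto_eventually[OF eventually_mono]) (auto simp: indicator_def)
    qed
  qed (use assms in \<open>auto simp: set_integrable_def indicator_def\<close>)
  moreover have "eventually (\<lambda>n. (LINT t|lborel. indicator {X n<..} t *\<^sub>R indicator {0<..} t *\<^sub>R f t)
      = (LBINT t:{X n<..}. f t)) sequentially"
  proof -
    have "eventually (\<lambda>n. 0 < X n) sequentially" using X by (simp add: filterlim_at_top_dense)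
    then show ?thesis
      by eventually_elim (auto simp: set_lebesgue_integral_def indicator_def intro!: Bochner_Integration.integral_cong)
  qed
  ultimately show "(\<lambda>n. LBINT t:{X n<..}. f t) \<longlonglongrightarrow> 0"
    by (simp add: tendsto_cong)
qed

lemma tail_integral_at_right_0:
  fixes f :: "real \<Rightarrow> real"
  assumes "set_integrable lborel {0<..} f"
  shows "((\<lambda>x. LBINT t:{x<..}. f t) \<longlongrightarrow> (LBINT t:{0<..}. f t)) (at_right 0)"
proof (rule tendsto_at_right_sequentially[of _ 1])
  fix X :: "nat \<Rightarrow> real"
  assume pos: "\<And>n. 0 < X n" and X: "X \<longlonglongrightarrow> 0"
  have "((\<lambda>n. LINT t|lborel. indicator {X n<..} t *\<^sub>R indicator {0<..} t *\<^sub>R f t)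
          \<longlonglongrightarrow> (LINT t|lborel. indicator {0<..} t *\<^sub>R f t))"
  proof (rule integral_dominated_convergence[where w = "\<lambda>t. norm (indicator {0<..} t *\<^sub>R f t)"])
    show "AE t in lborel. (\<lambda>n. indicator {X n<..} t *\<^sub>R indicator {0<..} t *\<^sub>R f t)
        \<longlonglongrightarrow> indicator {0<..} t *\<^sub>R f t"
    proof (rule AE_I2)
      fix t :: real
      show "(\<lambda>n. indicator {X n<..} t *\<^sub>R indicator {0<..} t *\<^sub>R f t) \<longlonglongrightarrow> indicator {0<..} t *\<^sub>R f t"
      proof (cases "0 < t")
        case True
        have "eventually (\<lambda>n. X n < t) sequentially"
          using order_tendstoD(2)[OF X True] .
        then show ?thesis
          by (rule tendsto_eventually[OF eventually_mono]) (use True in \<open>auto simp: indicator_def\<close>)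
      qed simp
    qed
  qed (use assms in \<open>auto simp: set_integrable_def indicator_def\<close>)
  moreover have "(LINT t|lborel. indicator {X n<..} t *\<^sub>R indicator {0<..} t *\<^sub>R f t)
      = (LBINT t:{X n<..}. f t)" for n
    using pos[of n]
    by (auto simp: set_lebesgue_integral_def indicator_def intro!: Bochner_Integration.integral_cong)
  ultimately show "(\<lambda>n. LBINT t:{X n<..}. f t) \<longlonglongrightarrow> (LBINT t:{0<..}. f t)"
    by (simp add: set_lebesgue_integral_def)
qed simp

text \<open>
A tail integral is a constant minus an ordinary integral over a compact interval. This transfers
continuity and the fundamental theorem of calculus to tail integrals. The base point \<open>c\<close> lies
strictly above \<open>a\<close>, so that \<open>f\<close> may be singular at \<open>a\<close>.
\<close>

lemma tail_integral_split:
  fixes f :: "real \<Rightarrow> real"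
  assumes int: "set_integrable lborel {a<..} f" and "a < c" "c \<le> y"
  shows "f integrable_on {c..y}"
    and "(LBINT t:{y<..}. f t) = (LBINT t:{c<..}. f t) - integral {c..y} f"
proof -
  have sub: "set_integrable lborel A f" if "A \<subseteq> {a<..}" "A \<in> sets lborel" for A
    using set_integrable_subset[OF int] that by auto
  show "f integrable_on {c..y}"
    by (rule set_borel_integral_eq_integral(1)) (use assms in \<open>auto intro!: sub\<close>)
  have "(LBINT t:{c<..}. f t) = (LBINT t:{c<..y} \<union> {y<..}. f t)"
    using assms by (simp add: ivl_disj_un_one(5))
  also have "\<dots> = (LBINT t:{c<..y}. f t) + (LBINT t:{y<..}. f t)"
    by (rule set_integral_Un) (use assms in \<open>auto intro!: sub\<close>)
  also have "(LBINT t:{c<..y}. f t) = integral {c<..y} f"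
    by (rule set_borel_integral_eq_integral) (use assms in \<open>auto intro!: sub\<close>)
  also have "\<dots> = integral {c..y} f"
    by (rule integral_subset_negligible) (auto intro!: negligible_subset[OF negligible_sing[of c]])
  finally show "(LBINT t:{y<..}. f t) = (LBINT t:{c<..}. f t) - integral {c..y} f" by simp
qed

lemma tail_integral_isCont:
  fixes f :: "real \<Rightarrow> real"
  assumes int: "set_integrable lborel {a<..} f" and "a < x"
  shows "isCont (\<lambda>x. LBINT t:{x<..}. f t) x"
proof -
  define c where "c = (a + x) / 2"
  have c: "a < c" "c < x" using \<open>a < x\<close> by (auto simp: c_def field_simps)
  have "continuous_on {c..x + 1} (\<lambda>y. (LBINT t:{c<..}. f t) - integral {c..y} f)"
    by (intro continuous_intros indefinite_integral_continuous_1 tail_integral_split(1)[OF int])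
      (use c in auto)
  then have "continuous_on {c<..<x + 1} (\<lambda>y. LBINT t:{y<..}. f t)"
  proof (rule continuous_on_eq[OF continuous_on_subset])
    fix y assume "y \<in> {c<..<x + 1}"
    then show "(LBINT t:{c<..}. f t) - integral {c..y} f = (LBINT t:{y<..}. f t)"
      by (subst tail_integral_split(2)[OF int c(1), of y]) auto
  qed auto
  then show ?thesis
    using c by (simp add: continuous_on_eq_continuous_at)
qed

lemma tail_integral_deriv:
  fixes f :: "real \<Rightarrow> real"
  assumes int: "set_integrable lborel {a<..} f" and cont: "continuous_on {a<..} f" and "a < x"
  shows "((\<lambda>x. LBINT t:{x<..}. f t) has_real_derivative - f x) (at x)"
proof -
  define c where "c = (a + x) / 2"
  have c: "a < c" "c < x" using \<open>a < x\<close> by (auto simp: c_def field_simps)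
  have "((\<lambda>y. integral {c..y} f) has_real_derivative f x) (at x within {c..x + 1})"
    by (rule integral_has_real_derivative) (use c in \<open>auto intro: continuous_on_subset[OF cont]\<close>)
  then have "((\<lambda>y. integral {c..y} f) has_real_derivative f x) (at x)"
    using c by (simp add: at_within_Icc_at)
  then have "((\<lambda>y. (LBINT t:{c<..}. f t) - integral {c..y} f) has_real_derivative - f x) (at x)"
    by (auto intro!: derivative_eq_intros)
  then show ?thesis
  proof (rule has_field_derivative_transform_within_open[where S = "{c<..<x + 1}"])
    fix y assume "y \<in> {c<..<x + 1}"
    then show "(LBINT t:{c<..}. f t) - integral {c..y} f = (LBINT t:{y<..}. f t)"
      by (subst tail_integral_split(2)[OF int c(1), of y]) auto
  qed (use c in auto)
qed

text \<open>
The Gronwall argument: multiplying by \<open>exp (\<integral> g)\<close> makes \<open>d\<close> nondecreasing. The factor \<open>E\<close> is the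
quotient of the values of the integrating factor at the end points. Its positivity carries the
sign of \<open>d\<close> from \<open>a\<close> to \<open>b\<close>; if \<open>E \<le> 1\<close>, a negative value at \<open>b\<close> bounds \<open>d\<close> away from 0 at \<open>a\<close>.
\<close>

lemma linear_differential_inequality:
  fixes d d' g :: "real \<Rightarrow> real"
  assumes "a \<le> b"
    and deriv: "\<And>x. x \<in> {a..b} \<Longrightarrow> (d has_real_derivative d' x) (at x)"
    and cont: "continuous_on {a..b} g"
    and ineq: "\<And>x. x \<in> {a..b} \<Longrightarrow> 0 \<le> d' x + g x * d x"
  shows "\<exists>E>0. ((\<forall>x\<in>{a..b}. 0 \<le> g x) \<longrightarrow> E \<le> 1) \<and> E * d a \<le> d b"
proof -
  obtain G where G: "\<And>x. x \<in> {a..b} \<Longrightarrow> (G has_vector_derivative g x) (at x within {a..b})"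
    using antiderivative_continuous[OF cont] by blast
  have G': "(G has_real_derivative g x) (at x within {a..b})" if "x \<in> {a..b}" for x
    using G[OF that] by (simp add: has_real_derivative_iff_has_vector_derivative)
  have "d a * exp (G a) \<le> d b * exp (G b)"
  proof (rule DERIV_nonneg_imp_increasing_open[OF \<open>a \<le> b\<close>, of "\<lambda>x. d x * exp (G x)"])
    fix x assume x: "a < x" "x < b"
    have "(G has_real_derivative g x) (at x)"
      using G'[of x] x by (simp add: at_within_Icc_at)
    then have "((\<lambda>x. d x * exp (G x)) has_real_derivative (d' x + g x * d x) * exp (G x)) (at x)"
      using deriv[of x] x by (auto intro!: derivative_eq_intros simp: algebra_simps)
    then show "\<exists>y. ((\<lambda>x. d x * exp (G x)) has_real_derivative y) (at x) \<and> 0 \<le> y"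
      using ineq[of x] x by (intro exI[of _ "(d' x + g x * d x) * exp (G x)"]) auto
  next
    show "continuous_on {a..b} (\<lambda>x. d x * exp (G x))"
      by (intro continuous_intros DERIV_continuous_on[OF G'] DERIV_continuous_on[where D = d'])
        (auto intro: DERIV_subset[OF deriv])
  qed
  moreover have "exp (G a - G b) \<le> 1" if g: "\<And>x. x \<in> {a..b} \<Longrightarrow> 0 \<le> g x"
  proof -
    have "G a \<le> G b"
    proof (rule DERIV_nonneg_imp_increasing_open[OF \<open>a \<le> b\<close>])
      fix x assume x: "a < x" "x < b"
      then show "\<exists>y. (G has_real_derivative y) (at x) \<and> 0 \<le> y"
        using G'[of x] g[of x] by (intro exI[of _ "g x"]) (simp add: at_within_Icc_at)
    qed (rule DERIV_continuous_on[OF G'])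
    then show ?thesis by simp
  qed
  ultimately show ?thesis
    by (intro exI[of _ "exp (G a - G b)"]) (auto simp: exp_diff field_simps)
qed

text \<open>
The instability principle for first order linear inequalities. Once \<open>f\<close> is nonnegative it stays
so, hence it increases and has a value \<open>\<delta> > 0\<close> at some point beyond \<open>X\<close>; from then on its slope is at least \<open>c \<delta>\<close>, which
contradicts boundedness.
\<close>

lemma bounded_subsolution_negative:
  fixes f f' g :: "real \<Rightarrow> real"
  assumes deriv: "\<And>x. 0 < x \<Longrightarrow> (f has_real_derivative f' x) (at x)"
    and cont: "continuous_on {0<..} g"
    and ineq: "\<And>x. 0 < x \<Longrightarrow> g x * f x < f' x"
    and g: "\<And>x. x \<ge> X \<Longrightarrow> c \<le> g x" and "0 < c"
    and bound: "\<And>x. 0 < x \<Longrightarrow> f x \<le> B"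
    and "0 < x"
  shows "f x < 0"
proof (rule ccontr)
  assume "\<not> f x < 0"
  have nonneg: "0 \<le> f y" if xy: "x \<le> y" for y
  proof -
    have "continuous_on {x..y} (\<lambda>x. - g x)"
      by (intro continuous_intros continuous_on_subset[OF cont]) (use \<open>0 < x\<close> in auto)
    then obtain E where "0 < E" "E * f x \<le> f y"
      using linear_differential_inequality[OF xy, of f f' "\<lambda>x. - g x"] \<open>0 < x\<close> ineq deriv
      by (auto simp: less_imp_le)
    then show ?thesis using \<open>\<not> f x < 0\<close> by (smt (verit) mult_nonneg_nonneg)
  qed
  define y where "y = max X x + 1"
  have y: "0 < y" "x < y" "X \<le> y - 1" "x \<le> y - 1" "0 < y - 1" using \<open>0 < x\<close> by (auto simp: y_def)
  have incr: "f u < f v" if "y - 1 \<le> u" "u < v" for u v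
  proof (rule DERIV_pos_imp_increasing[OF \<open>u < v\<close>])
    fix z assume z: "u \<le> z" "z \<le> v"
    have "0 \<le> g z * f z" using g[of z] nonneg[of z] y z that \<open>0 < c\<close> by auto
    then show "\<exists>D. (f has_real_derivative D) (at z) \<and> 0 < D"
      using deriv[of z] ineq[of z] y z that by (intro exI[of _ "f' z"]) auto
  qed
  define \<delta> where "\<delta> = f y"
  have "0 < \<delta>" using incr[of "y-1" y] nonneg[of "y-1"] y by (auto simp: \<delta>_def)
  \<comment> \<open>The slope of \<open>f\<close> beyond \<open>y\<close> is at least \<open>c * \<delta>\<close>, so \<open>f\<close> lies above a line.\<close>
  have lin: "\<delta> + c * \<delta> * (z - y) \<le> f z" if "y \<le> z" for z
  proof -
    have "f y - c * \<delta> * y \<le> f z - c * \<delta> * z"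
    proof (rule DERIV_nonneg_imp_nondecreasing[OF that])
      fix t assume t: "y \<le> t" "t \<le> z"
      have "\<delta> \<le> f t" using incr[of y t] t y by (cases "y = t") (auto simp: \<delta>_def)
      then have "c * \<delta> \<le> g t * f t"
        using g[of t] y t \<open>0 < c\<close> \<open>0 < \<delta>\<close> by (intro mult_mono) auto
      then show "\<exists>D. ((\<lambda>z. f z - c * \<delta> * z) has_real_derivative D) (at t) \<and> 0 \<le> D"
        using deriv[of t] ineq[of t] y t
        by (intro exI[of _ "f' t - c * \<delta>"]) (auto intro!: derivative_eq_intros)
    qed
    then show ?thesis by (simp add: \<delta>_def algebra_simps)
  qed
  have "B \<ge> \<delta>" using bound[of y] y by (simp add: \<delta>_def)
  have "\<delta> + c * \<delta> * (B / (c * \<delta>)) \<le> f (y + B / (c * \<delta>))"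
    using lin[of "y + B / (c * \<delta>)"] \<open>0 < c\<close> \<open>0 < \<delta>\<close> \<open>B \<ge> \<delta>\<close> by simp
  also have "\<dots> \<le> B"
    using \<open>0 < c\<close> \<open>0 < \<delta>\<close> \<open>B \<ge> \<delta>\<close> y by (intro bound add_pos_nonneg) auto
  finally show False using \<open>0 < c\<close> \<open>0 < \<delta>\<close> by simp
qed

section \<open>The modified Bessel function of the first kind\<close>

text \<open>
The entire factor of the Bessel function: \<open>I\<^bsub>\<nu>\<^esub>(x) = (x/2)\<^bsup>\<nu>\<^esup> F\<^bsub>\<nu>\<^esub>(x\<^sup>2/4)\<close>. Its derivative is
\<open>F\<^bsub>\<nu>+1\<^esub>\<close>, so the calculus of \<open>I\<^bsub>\<nu>\<^esub>\<close> reduces to index shifts.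
\<close>

definition bessel_series :: "real \<Rightarrow> real \<Rightarrow> real" where
  "bessel_series \<nu> y = (\<Sum>k. rGamma (\<nu> + real k + 1) / fact k * y ^ k)"

lemma bessel_series_summable:
  assumes "\<nu> > -1"
  shows "summable (\<lambda>k. rGamma (\<nu> + real k + 1) / fact k * y ^ k)"
proof (rule summable_ratio_test[of "1/2" "nat \<lceil>2 * \<bar>y\<bar> + 1\<rceil>"])
  fix n assume n: "nat \<lceil>2 * \<bar>y\<bar> + 1\<rceil> \<le> n"
  have nn: "2 * \<bar>y\<bar> + 1 \<le> real n" using n by linarith
  define p where "p = \<nu> + real n + 1"
  have p: "0 < p" "real n \<le> p" using assms by (auto simp: p_def)
  have rec: "rGamma (\<nu> + real (Suc n) + 1) = rGamma p / p"
    using rGamma_plus1[of p] p by (simp add: p_def field_simps)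
  have "2 * \<bar>y\<bar> * 1 \<le> p * real (Suc n)"
    using nn p by (intro mult_mono) auto
  then have "\<bar>y\<bar> / (p * real (Suc n)) \<le> 1/2"
    using p by (subst pos_divide_le_eq) auto
  then have "\<bar>y\<bar> / (p * real (Suc n)) * norm (rGamma p / fact n * y ^ n) \<le> 1/2 * norm (rGamma p / fact n * y ^ n)"
    by (rule mult_right_mono) simp
  moreover have "norm (rGamma p / p / fact (Suc n) * y ^ Suc n) = \<bar>y\<bar> / (p * real (Suc n)) * norm (rGamma p / fact n * y ^ n)"
    using p by (simp add: abs_mult power_abs field_simps)
  ultimately show "norm (rGamma (\<nu> + real (Suc n) + 1) / fact (Suc n) * y ^ Suc n)
      \<le> 1/2 * norm (rGamma (\<nu> + real n + 1) / fact n * y ^ n)"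
    unfolding rec p_def[symmetric] by simp
qed simp

lemma bessel_series_deriv:
  assumes "\<nu> > -1"
  shows "(bessel_series \<nu> has_real_derivative bessel_series (\<nu> + 1) y) (at y)"
proof -
  have eq: "diffs (\<lambda>k. rGamma (\<nu> + real k + 1) / fact k) = (\<lambda>k. rGamma (\<nu> + 1 + real k + 1) / fact k)"
  proof
    fix k
    have "\<nu> + real (Suc k) + 1 = \<nu> + 1 + real k + 1" by simp
    then show "diffs (\<lambda>k. rGamma (\<nu> + real k + 1) / fact k) k = rGamma (\<nu> + 1 + real k + 1) / fact k"
      unfolding diffs_def by (simp only: fact_Suc) (simp add: field_simps del: of_nat_Suc)
  qed
  show ?thesis
    using termdiffs_strong_converges_everywhere[OF bessel_series_summable[OF assms], of y]
    unfolding bessel_series_def[abs_def] eq .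
qed

text \<open>
On coefficients this is the functional equation of the Gamma function,
\<open>1/\<Gamma>(\<nu>+k+1) = ((\<nu>+1) + k)/\<Gamma>(\<nu>+k+2)\<close>; the summand with the factor \<open>k\<close> is the shifted series.
\<close>

lemma bessel_series_recurrence:
  assumes "\<nu> > -1"
  shows "bessel_series \<nu> y = (\<nu> + 1) * bessel_series (\<nu> + 1) y + y * bessel_series (\<nu> + 2) y"
proof -
  define c where "c = (\<lambda>k. rGamma (\<nu> + real k + 2) / fact k * y ^ k)"
  have c: "summable c" and cs: "bessel_series (\<nu> + 1) y = suminf c"
    using bessel_series_summable[of "\<nu> + 1" y] assms by (simp_all add: c_def bessel_series_def add_ac)
  have "(\<lambda>k. real (Suc k) * c (Suc k)) = (\<lambda>k. y * (rGamma (\<nu> + 2 + real k + 1) / fact k * y ^ k))"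
  proof
    fix k
    have "\<nu> + real (Suc k) + 2 = \<nu> + 2 + real k + 1" by simp
    then show "real (Suc k) * c (Suc k) = y * (rGamma (\<nu> + 2 + real k + 1) / fact k * y ^ k)"
      unfolding c_def by (simp only: fact_Suc) (simp add: field_simps del: of_nat_Suc)
  qed
  moreover have "(\<lambda>k. y * (rGamma (\<nu> + 2 + real k + 1) / fact k * y ^ k)) sums (y * bessel_series (\<nu> + 2) y)"
    unfolding bessel_series_def by (intro sums_mult summable_sums bessel_series_summable) (use assms in auto)
  ultimately have "(\<lambda>k. real (Suc k) * c (Suc k)) sums (y * bessel_series (\<nu> + 2) y)" by simp
  then have "(\<lambda>k. real k * c k) sums (y * bessel_series (\<nu> + 2) y)"
    using sums_Suc_iff[of "\<lambda>k. real k * c k" "y * bessel_series (\<nu> + 2) y"] by simp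
  then have "(\<lambda>k. (\<nu> + 1) * c k + real k * c k) sums ((\<nu> + 1) * bessel_series (\<nu> + 1) y + y * bessel_series (\<nu> + 2) y)"
    unfolding cs using c by (intro sums_add sums_mult summable_sums)
  moreover have "(\<lambda>k. (\<nu> + 1) * c k + real k * c k) = (\<lambda>k. rGamma (\<nu> + real k + 1) / fact k * y ^ k)"
  proof
    fix k
    show "(\<nu> + 1) * c k + real k * c k = rGamma (\<nu> + real k + 1) / fact k * y ^ k"
      unfolding c_def rGamma_plus1[of "\<nu> + real k + 1", symmetric] by (simp add: algebra_simps add_divide_distrib)
  qed
  ultimately show ?thesis unfolding bessel_series_def by (simp add: sums_iff)
qed

lemma bessel_series_pos:
  assumes "\<nu> > -1" "0 \<le> y"
  shows "0 < bessel_series \<nu> y"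
proof -
  have nn: "0 < rGamma (\<nu> + real k + 1) / fact k" for k
    using Gamma_real_pos[of "\<nu> + real k + 1"] assms by (auto simp: rGamma_inverse_Gamma)
  have "(\<Sum>k<1. rGamma (\<nu> + real k + 1) / fact k * y ^ k) \<le> bessel_series \<nu> y"
    unfolding bessel_series_def using nn assms
    by (intro sum_le_suminf bessel_series_summable mult_nonneg_nonneg less_imp_le[OF nn]) auto
  then show ?thesis using nn[of 0] by simp
qed

lemma bessel_I_eq_series:
  assumes "0 < x" "\<nu> > -1"
  shows "bessel_I \<nu> x = (x/2) powr \<nu> * bessel_series \<nu> ((x/2)\<^sup>2)"
proof -
  have *: "(x/2) powr (\<nu> + 2 * real k) = (x/2) powr \<nu> * ((x/2)\<^sup>2) ^ k" for k
    using assms powr_realpow[of "x/2" "2*k"] by (simp add: powr_add power_mult)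
  show ?thesis
    unfolding bessel_I_def bessel_series_def *
    by (subst suminf_mult[OF bessel_series_summable[OF assms(2)], symmetric])
       (simp add: algebra_simps)
qed

lemma bessel_I_pos: "0 < x \<Longrightarrow> \<nu> > -1 \<Longrightarrow> 0 < bessel_I \<nu> x"
  by (simp add: bessel_I_eq_series bessel_series_pos)

lemma bessel_I_recurrence:
  assumes "0 < x" "\<nu> > -1"
  shows "bessel_I \<nu> x = 2 * (\<nu> + 1) / x * bessel_I (\<nu> + 1) x + bessel_I (\<nu> + 2) x"
proof -
  define P where "P = (x/2) powr \<nu>"
  have "(x/2) powr (\<nu> + 1) = P * (x/2)" "(x/2) powr (\<nu> + 2) = P * (x/2)\<^sup>2"
    using assms powr_realpow[of "x/2" 2] by (simp_all add: P_def powr_add)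
  then have I: "bessel_I (\<nu> + 1) x = P * (x/2) * bessel_series (\<nu> + 1) ((x/2)\<^sup>2)"
    "bessel_I (\<nu> + 2) x = P * (x/2)\<^sup>2 * bessel_series (\<nu> + 2) ((x/2)\<^sup>2)"
    using assms by (simp_all add: bessel_I_eq_series)
  have "bessel_I \<nu> x = P * ((\<nu> + 1) * bessel_series (\<nu> + 1) ((x/2)\<^sup>2) + (x/2)\<^sup>2 * bessel_series (\<nu> + 2) ((x/2)\<^sup>2))"
    unfolding P_def bessel_series_recurrence[OF assms(2), symmetric] by (rule bessel_I_eq_series[OF assms])
  moreover have "2 * (\<nu> + 1) / x * (P * (x/2) * F) = P * ((\<nu> + 1) * F)" for F
    using assms by simp
  ultimately show ?thesis unfolding I by (simp add: distrib_left)
qed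

lemma bessel_I_deriv:
  assumes "0 < x" "\<nu> > -1"
  shows "(bessel_I \<nu> has_real_derivative bessel_I (\<nu> + 1) x + \<nu> / x * bessel_I \<nu> x) (at x)"
proof -
  have *: "(x/2) powr (\<nu> + 1) = (x/2) powr \<nu> * (x/2)" "(x/2) powr (\<nu> - 1) = (x/2) powr \<nu> * (2/x)"
    using assms by (simp_all add: powr_add powr_diff)
  have "((\<lambda>x. (x/2) powr \<nu>) has_real_derivative \<nu> * (x/2) powr (\<nu> - 1) * (1/2)) (at x)"
    using assms by (auto intro!: derivative_eq_intros)
  moreover have "((\<lambda>x. bessel_series \<nu> ((x/2)\<^sup>2)) has_real_derivative bessel_series (\<nu> + 1) ((x/2)\<^sup>2) * (x/2)) (at x)"
    by (rule DERIV_chain2[OF bessel_series_deriv])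
      (use assms in \<open>auto intro!: derivative_eq_intros\<close>)
  ultimately have "((\<lambda>x. (x/2) powr \<nu> * bessel_series \<nu> ((x/2)\<^sup>2)) has_real_derivative
        \<nu> * (x/2) powr (\<nu> - 1) * (1/2) * bessel_series \<nu> ((x/2)\<^sup>2)
        + bessel_series (\<nu> + 1) ((x/2)\<^sup>2) * (x/2) * (x/2) powr \<nu>) (at x)"
    by (rule DERIV_mult)
  moreover have "\<nu> * (x/2) powr (\<nu> - 1) * (1/2) * bessel_series \<nu> ((x/2)\<^sup>2)
        + bessel_series (\<nu> + 1) ((x/2)\<^sup>2) * (x/2) * (x/2) powr \<nu>
      = bessel_I (\<nu> + 1) x + \<nu> / x * bessel_I \<nu> x"
    using assms by (simp add: bessel_I_eq_series *) (simp add: mult_ac)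
  ultimately have "((\<lambda>x. (x/2) powr \<nu> * bessel_series \<nu> ((x/2)\<^sup>2)) has_real_derivative
        bessel_I (\<nu> + 1) x + \<nu> / x * bessel_I \<nu> x) (at x)"
    by simp
  then show ?thesis
    by (rule has_field_derivative_transform_within_open[where S = "{0<..}"])
       (use assms in \<open>auto simp: bessel_I_eq_series\<close>)
qed

lemma bessel_I_deriv':
  assumes "0 < x" "\<nu> > -1"
  shows "(bessel_I (\<nu> + 1) has_real_derivative bessel_I \<nu> x - (\<nu> + 1) / x * bessel_I (\<nu> + 1) x) (at x)"
proof -
  have "bessel_I \<nu> x - (\<nu> + 1) / x * bessel_I (\<nu> + 1) x
      = bessel_I (\<nu> + 1 + 1) x + (\<nu> + 1) / x * bessel_I (\<nu> + 1) x"
    using bessel_I_recurrence[OF assms] by (simp add: add_ac)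
  moreover have "\<nu> + 1 > -1" using assms by simp
  ultimately show ?thesis using bessel_I_deriv[OF assms(1), of "\<nu> + 1"] by (simp only:)
qed

lemma bessel_I_at_right_0:
  assumes "\<nu> > -1"
  shows "((\<lambda>x. bessel_I \<nu> x / x powr \<nu>) \<longlongrightarrow> 1 / (2 powr \<nu> * Gamma (\<nu> + 1))) (at_right 0)"
proof -
  have "isCont (bessel_series \<nu>) 0"
    using bessel_series_deriv[OF assms] by (rule DERIV_isCont)
  moreover have "bessel_series \<nu> 0 = 1 / Gamma (\<nu> + 1)"
    unfolding bessel_series_def using powser_zero[of "\<lambda>k. rGamma (\<nu> + real k + 1) / fact k"]
    by (simp add: rGamma_inverse_Gamma inverse_eq_divide)
  moreover have "((\<lambda>x. (x/2)\<^sup>2) \<longlongrightarrow> 0) (at_right (0::real))"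
    by (auto intro!: tendsto_eq_intros)
  ultimately have "((\<lambda>x. bessel_series \<nu> ((x/2)\<^sup>2)) \<longlongrightarrow> 1 / Gamma (\<nu> + 1)) (at_right 0)"
    using isCont_tendsto_compose by fastforce
  then have "((\<lambda>x. bessel_series \<nu> ((x/2)\<^sup>2) / 2 powr \<nu>) \<longlongrightarrow> 1 / Gamma (\<nu> + 1) / 2 powr \<nu>) (at_right 0)"
    by (intro tendsto_divide tendsto_const) auto
  moreover have "eventually (\<lambda>x. bessel_series \<nu> ((x/2)\<^sup>2) / 2 powr \<nu> = bessel_I \<nu> x / x powr \<nu>) (at_right 0)"
    using eventually_at_right_less[of 0]
    by eventually_elim (use assms in \<open>simp add: bessel_I_eq_series powr_divide\<close>)
  ultimately show ?thesis by (simp add: tendsto_cong mult.commute)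
qed

section \<open>Bounds for the ratio of consecutive I\<close>

definition bessel_I_ratio :: "real \<Rightarrow> real \<Rightarrow> real" where
  "bessel_I_ratio \<nu> x = bessel_I (\<nu> + 1) x / bessel_I \<nu> x"

lemma bessel_I_ratio_pos: "0 < x \<Longrightarrow> \<nu> > -1 \<Longrightarrow> 0 < bessel_I_ratio \<nu> x"
  by (simp add: bessel_I_ratio_def bessel_I_pos)

lemma bessel_I_ratio_le:
  assumes "0 < x" "\<nu> > -1"
  shows "bessel_I_ratio \<nu> x \<le> x / (2 * \<nu> + 2)"
  using bessel_I_recurrence[OF assms] bessel_I_pos[of x \<nu>] bessel_I_pos[of x "\<nu> + 2"] assms
  by (simp add: bessel_I_ratio_def field_simps)

text \<open>
The Riccati equation that drives all the bounds on the ratio.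
\<close>

lemma bessel_I_ratio_deriv:
  assumes "0 < x" "\<nu> > -1"
  shows "(bessel_I_ratio \<nu> has_real_derivative
           1 - (bessel_I_ratio \<nu> x)\<^sup>2 - (2 * \<nu> + 1) / x * bessel_I_ratio \<nu> x) (at x)"
proof -
  have pos: "bessel_I \<nu> x \<noteq> 0" using bessel_I_pos[OF assms] by simp
  have "(i - (\<nu> + 1) / x * j) * i - j * (j + \<nu> / x * i) = (1 - (j / i)\<^sup>2 - (2 * \<nu> + 1) / x * (j / i)) * (i * i)"
    if "i \<noteq> 0" for i j :: real
    using assms that by (simp add: field_simps power2_eq_square)
  from this[OF pos, of "bessel_I (\<nu> + 1) x"] show ?thesis
    using DERIV_divide[OF bessel_I_deriv'[OF assms] bessel_I_deriv[OF assms] pos] pos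
    unfolding bessel_I_ratio_def[abs_def] by simp
qed

text \<open>
Comparison for the Riccati equation: the difference of a solution and a subsolution \<open>b\<close> satisfies
a linear differential inequality.
\<close>

lemma bessel_I_ratio_subsolution:
  assumes "0 < x\<^sub>0" "x\<^sub>0 \<le> x" "\<nu> \<ge> -1/2"
    and deriv: "\<And>t. x\<^sub>0 \<le> t \<Longrightarrow> (b has_real_derivative b' t) (at t)"
    and lower: "\<And>t. x\<^sub>0 \<le> t \<Longrightarrow> b' t \<le> 1 - (b t)\<^sup>2 - (2 * \<nu> + 1) / t * b t"
  shows "\<exists>E>0. ((\<forall>t\<ge>x\<^sub>0. 0 \<le> b t) \<longrightarrow> E \<le> 1) \<and>
     E * (bessel_I_ratio \<nu> x\<^sub>0 - b x\<^sub>0) \<le> bessel_I_ratio \<nu> x - b x"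
proof -
  let ?r = "bessel_I_ratio \<nu>"
  let ?g = "\<lambda>t. ?r t + b t + (2 * \<nu> + 1) / t"
  have cont: "continuous_on {x\<^sub>0..x} ?g"
    using assms by (intro continuous_intros continuous_at_imp_continuous_on ballI)
      (auto intro!: DERIV_isCont[OF deriv] DERIV_isCont[OF bessel_I_ratio_deriv])
  have "\<exists>E>0. ((\<forall>t\<in>{x\<^sub>0..x}. 0 \<le> ?g t) \<longrightarrow> E \<le> 1) \<and> E * (?r x\<^sub>0 - b x\<^sub>0) \<le> ?r x - b x"
  proof (rule linear_differential_inequality[OF \<open>x\<^sub>0 \<le> x\<close> _ cont])
    fix t assume t: "t \<in> {x\<^sub>0..x}"
    show "((\<lambda>t. ?r t - b t) has_real_derivative (1 - (?r t)\<^sup>2 - (2 * \<nu> + 1) / t * ?r t) - b' t) (at t)"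
      by (intro DERIV_diff bessel_I_ratio_deriv deriv) (use t assms in auto)
    have "(1 - (?r t)\<^sup>2 - q * ?r t) - b' t + (?r t + b t + q) * (?r t - b t) = 1 - (b t)\<^sup>2 - q * b t - b' t" for q
      by (simp add: algebra_simps power2_eq_square)
    then show "0 \<le> (1 - (?r t)\<^sup>2 - (2 * \<nu> + 1) / t * ?r t) - b' t + ?g t * (?r t - b t)"
      using lower[of t] t by (metis atLeastAtMost_iff diff_ge_0_iff_ge)
  qed
  moreover have "0 \<le> ?g t" if "t \<in> {x\<^sub>0..x}" "\<forall>t\<ge>x\<^sub>0. 0 \<le> b t" for t
    using that assms bessel_I_ratio_pos[of t \<nu>] by (auto intro!: add_nonneg_nonneg)
  ultimately show ?thesis by blast
qed

text \<open>
Amos's bound. The bounding function is a subsolution that vanishes at 0. If the bound failed at \<open>x\<close>,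
the deficit could not shrink when going back towards 0, since the linear coefficient in the
comparison is nonnegative; but near 0 the deficit is at most the value of the subsolution, which
tends to 0.
\<close>

lemma bessel_I_ratio_ge_Amos:
  assumes "0 < x" "\<nu> > -1/2"
  shows "x / (sqrt (x\<^sup>2 + (\<nu> + 3/2)\<^sup>2) + \<nu> + 1/2) \<le> bessel_I_ratio \<nu> x"
proof (rule ccontr)
  define a p S where "a = \<nu> + 1/2" and "p = a + 1" and "S = (\<lambda>t. sqrt (t\<^sup>2 + p\<^sup>2))"
  define b where "b = (\<lambda>t. t / (S t + a))"
  define \<delta> where "\<delta> = b x - bessel_I_ratio \<nu> x"
  assume "\<not> ?thesis"
  then have "0 < \<delta>" by (simp add: \<delta>_def b_def S_def p_def a_def add_ac)
  have a: "0 < a" "0 < p" using assms by (auto simp: a_def p_def)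
  have S: "p \<le> S t" "(S t)\<^sup>2 = t\<^sup>2 + p\<^sup>2" for t
    using a by (auto simp: S_def real_le_rsqrt)
  have deriv: "(b has_real_derivative ((S t + a) - t * (t / S t)) / (S t + a)\<^sup>2) (at t)" for t
  proof -
    have "(S has_real_derivative t / S t) (at t)"
      unfolding S_def using a add_nonneg_pos[of "t\<^sup>2" "p\<^sup>2"]
      by (auto intro!: derivative_eq_intros simp: field_simps)
    then show ?thesis
      unfolding b_def using S(1)[of t] a by (auto intro!: derivative_eq_intros simp: power2_eq_square)
  qed
  have lower: "((S t + a) - t * (t / S t)) / (S t + a)\<^sup>2 \<le> 1 - (b t)\<^sup>2 - (2 * \<nu> + 1) / t * b t"
    if "0 < t" for t
  proof -
    have pos: "0 < S t" "0 < S t + a" using S(1)[of t] a by auto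
    have "((S t + a)\<^sup>2 - t\<^sup>2 - 2 * a * (S t + a)) - ((S t + a) - t * (t / S t)) = p * (S t - p) / S t"
      using pos S(2)[of t] by (simp add: field_simps power2_eq_square p_def)
    moreover have "0 \<le> p * (S t - p) / S t" using pos S(1)[of t] a by simp
    ultimately have "((S t + a) - t * (t / S t)) \<le> (S t + a)\<^sup>2 - t\<^sup>2 - 2 * a * (S t + a)" by simp
    then have "((S t + a) - t * (t / S t)) / (S t + a)\<^sup>2 \<le> ((S t + a)\<^sup>2 - t\<^sup>2 - 2 * a * (S t + a)) / (S t + a)\<^sup>2"
      by (rule divide_right_mono) simp
    also have "\<dots> = 1 - (b t)\<^sup>2 - (2 * \<nu> + 1) / t * b t"
    proof -
      have "((S t + a)\<^sup>2 - t\<^sup>2 - 2 * a * (S t + a)) / (S t + a)\<^sup>2 = 1 - t\<^sup>2 / (S t + a)\<^sup>2 - 2 * a / (S t + a)"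
        using pos by (simp add: diff_divide_distrib power2_eq_square)
      then show ?thesis using that by (simp add: b_def power_divide a_def)
    qed
    finally show ?thesis .
  qed
  \<comment> \<open>A point so close to 0 that the subsolution is smaller there than the deficit \<open>\<delta>\<close> at \<open>x\<close>.\<close>
  define t where "t = min x (\<delta> * p / 2)"
  have t: "0 < t" "t \<le> x" "t \<le> \<delta> * p / 2" using \<open>0 < \<delta>\<close> a assms by (auto simp: t_def)
  have "\<exists>E>0. ((\<forall>u\<ge>t. 0 \<le> b u) \<longrightarrow> E \<le> 1) \<and>
     E * (bessel_I_ratio \<nu> t - b t) \<le> bessel_I_ratio \<nu> x - b x"
    by (rule bessel_I_ratio_subsolution[OF t(1,2) _ deriv lower]) (use assms t in auto)
  moreover have "0 \<le> b u" if "t \<le> u" for u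
    using that t S(1)[of u] a by (simp add: b_def)
  ultimately obtain E where E: "0 < E" "E \<le> 1" "E * (bessel_I_ratio \<nu> t - b t) \<le> - \<delta>"
    by (auto simp: \<delta>_def)
  have "b t \<le> t / p" unfolding b_def using t S(1)[of t] a by (intro divide_left_mono) auto
  also have "\<dots> < \<delta>" using t a \<open>0 < \<delta>\<close> by (simp add: field_simps)
  finally have "- \<delta> < bessel_I_ratio \<nu> t - b t" using bessel_I_ratio_pos[of t \<nu>] t assms by simp
  then have "E * (- \<delta>) < E * (bessel_I_ratio \<nu> t - b t)"
    using E by (intro mult_strict_left_mono)
  moreover have "- \<delta> \<le> E * (- \<delta>)" using E \<open>0 < \<delta>\<close> by (simp add: mult_left_le_one_le)
  ultimately show False using E by linarith
qed

text \<open>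
The constant 1 is a supersolution of the Riccati equation, and the ratio is small near 0.
\<close>

lemma bessel_I_ratio_lt_1:
  assumes "0 < x" "\<nu> > -1/2"
  shows "bessel_I_ratio \<nu> x < 1"
proof -
  let ?r = "bessel_I_ratio \<nu>"
  define t where "t = min x (1/2)"
  have t: "0 < t" "t \<le> x" using assms by (auto simp: t_def)
  have cont: "continuous_on {t..x} (\<lambda>t. 1 + ?r t)"
    using assms t by (intro continuous_intros continuous_at_imp_continuous_on ballI)
      (auto intro!: DERIV_isCont[OF bessel_I_ratio_deriv])
  have "\<exists>E>0. ((\<forall>t\<in>{t..x}. 0 \<le> 1 + ?r t) \<longrightarrow> E \<le> 1) \<and> E * (1 - ?r t) \<le> 1 - ?r x"
  proof (rule linear_differential_inequality[OF t(2) _ cont])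
    fix u assume u: "u \<in> {t..x}"
    show "((\<lambda>u. 1 - ?r u) has_real_derivative - (1 - (?r u)\<^sup>2 - (2 * \<nu> + 1) / u * ?r u)) (at u)"
      using u t assms by (auto intro!: derivative_eq_intros bessel_I_ratio_deriv)
    have "0 \<le> (2 * \<nu> + 1) / u * ?r u"
      using u t assms bessel_I_ratio_pos[of u \<nu>] by (intro mult_nonneg_nonneg) auto
    then show "0 \<le> - (1 - (?r u)\<^sup>2 - (2 * \<nu> + 1) / u * ?r u) + (1 + ?r u) * (1 - ?r u)"
      by (simp add: algebra_simps power2_eq_square)
  qed
  moreover have "?r t < 1"
  proof -
    have "?r t \<le> t / (2 * \<nu> + 2)" using bessel_I_ratio_le[of t \<nu>] t assms by simp
    also have "\<dots> < 1" using assms by (simp add: t_def field_simps)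
    finally show ?thesis .
  qed
  ultimately obtain E where E: "0 < E" "E * (1 - ?r t) \<le> 1 - ?r x" "?r t < 1" by blast
  then have "0 < E * (1 - ?r t)" by simp
  then show ?thesis using E by linarith
qed

text \<open>
For \<open>a \<ge> 1\<close> the function \<open>1 - a/x\<close> is a subsolution on the whole half line, and it is negative near
0, where the comparison starts.
\<close>

lemma bessel_I_ratio_gt_large_order:
  assumes "0 < x" "\<nu> \<ge> 1/2"
  shows "1 - (\<nu> + 1/2) / x < bessel_I_ratio \<nu> x"
proof -
  define a where "a = \<nu> + 1/2"
  have a: "1 \<le> a" using assms by (simp add: a_def)
  let ?b = "\<lambda>x. 1 - a / x"
  define t where "t = min x (1/2)"
  have t: "0 < t" "t \<le> x" "t \<le> 1/2" using assms by (auto simp: t_def)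
  have "\<exists>E>0. ((\<forall>u\<ge>t. 0 \<le> ?b u) \<longrightarrow> E \<le> 1) \<and>
     E * (bessel_I_ratio \<nu> t - ?b t) \<le> bessel_I_ratio \<nu> x - ?b x"
  proof (rule bessel_I_ratio_subsolution[OF t(1,2), of _ _ "\<lambda>u. a / u\<^sup>2"])
    fix u assume u: "t \<le> u"
    show "(?b has_real_derivative a / u\<^sup>2) (at u)"
      using u t by (auto intro!: derivative_eq_intros simp: power2_eq_square)
    have "1 - (?b u)\<^sup>2 - (2 * \<nu> + 1) / u * ?b u - a / u\<^sup>2 = (a\<^sup>2 - a) / u\<^sup>2"
      using u t by (simp add: a_def field_simps power2_eq_square)
    moreover have "0 \<le> (a\<^sup>2 - a) / u\<^sup>2" using a by (simp add: power2_eq_square)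
    ultimately show "a / u\<^sup>2 \<le> 1 - (?b u)\<^sup>2 - (2 * \<nu> + 1) / u * ?b u" by linarith
  qed (use assms in auto)
  moreover have "?b t < bessel_I_ratio \<nu> t"
  proof -
    have "?b t < 0" using t a by (simp add: field_simps)
    also have "0 < bessel_I_ratio \<nu> t" using t assms by (intro bessel_I_ratio_pos) auto
    finally show ?thesis .
  qed
  ultimately obtain E where E: "0 < E" "E * (bessel_I_ratio \<nu> t - ?b t) \<le> bessel_I_ratio \<nu> x - ?b x"
      "?b t < bessel_I_ratio \<nu> t" by blast
  then have "0 < E * (bessel_I_ratio \<nu> t - ?b t)" by simp
  then show ?thesis using E unfolding a_def by linarith
qed

text \<open>
The function \<open>1 - m/(3x)\<close> with \<open>m = 2\<nu>+2 \<le> 3\<close> is a subsolution for \<open>x \<ge> 2m/3\<close>. Up to that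
point it lies strictly below Amos's bound, which provides the starting value. The form of the bound
comes from the square in the proof of \<open>bessel_product_lt_small_order\<close>.
\<close>

lemma bessel_I_ratio_gt_small_order:
  assumes "0 < x" "-1/2 < \<nu>" "\<nu> \<le> 1/2"
  shows "1 - (2 * \<nu> + 2) / (3 * x) < bessel_I_ratio \<nu> x"
proof -
  define m where "m = 2 * \<nu> + 2"
  have m: "1 < m" "m \<le> 3" using assms by (auto simp: m_def)
  let ?b = "\<lambda>x. 1 - m / (3 * x)"
  have near: "?b t < bessel_I_ratio \<nu> t" if t: "0 < t" "t \<le> 2 * m / 3" for t
  proof -
    \<comment> \<open>Amos's bound at \<open>t\<close> is \<open>t / S\<close>.\<close>
    define S where "S = sqrt (t\<^sup>2 + ((m + 1) / 2)\<^sup>2) + (m - 1) / 2"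
    have S0: "0 < S" unfolding S_def using m by (intro add_nonneg_pos) auto
    have "sqrt (t\<^sup>2 + ((m + 1) / 2)\<^sup>2) < 4 * m / 3 - (m - 1) / 2"
    proof (rule real_less_lsqrt)
      have "t\<^sup>2 \<le> (2 * m / 3)\<^sup>2" using t by (intro power_mono) auto
      moreover have "(2 * m / 3)\<^sup>2 + ((m + 1) / 2)\<^sup>2 < (4 * m / 3 - (m - 1) / 2)\<^sup>2"
        using m by (simp add: power2_eq_square field_simps)
      ultimately show "t\<^sup>2 + ((m + 1) / 2)\<^sup>2 < (4 * m / 3 - (m - 1) / 2)\<^sup>2" by linarith
    qed (use m in auto)
    then have S: "S < 4 * m / 3" unfolding S_def by linarith
    have "?b t * S < t"
    proof (cases "?b t \<le> 0")
      case True
      then have "?b t * S \<le> 0" using S0 by (simp add: mult_nonpos_nonneg)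
      then show ?thesis using t by linarith
    next
      case False
      then have "?b t * S < ?b t * (4 * m / 3)" using S by simp
      also have "\<dots> \<le> t"
      proof -
        \<comment> \<open>The two sides touch at \<open>t = 2m/3\<close>, so their difference is a square.\<close>
        have "0 \<le> (3 * t - 2 * m)\<^sup>2 / (9 * t)" using t by simp
        also have "\<dots> = t - ?b t * (4 * m / 3)" using t by (simp add: field_simps power2_eq_square)
        finally show ?thesis by simp
      qed
      finally show ?thesis .
    qed
    then have "?b t < t / S" using S0 by (simp add: field_simps)
    also have "\<dots> \<le> bessel_I_ratio \<nu> t"
    proof -
      have e: "(m + 1) / 2 = \<nu> + 3/2" "(m - 1) / 2 = \<nu> + 1/2" by (simp_all add: m_def field_simps)
      show ?thesis using bessel_I_ratio_ge_Amos[of t \<nu>] t assms unfolding S_def e by (simp add: add.assoc)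
    qed
    finally show ?thesis .
  qed
  show ?thesis
  proof (cases "x \<le> 2 * m / 3")
    case True
    then show ?thesis using near[of x] assms by (simp add: m_def)
  next
    case False
    define t where "t = 2 * m / 3"
    have t: "0 < t" "t \<le> x" using m False by (auto simp: t_def)
    have "\<exists>E>0. ((\<forall>u\<ge>t. 0 \<le> ?b u) \<longrightarrow> E \<le> 1) \<and>
       E * (bessel_I_ratio \<nu> t - ?b t) \<le> bessel_I_ratio \<nu> x - ?b x"
    proof (rule bessel_I_ratio_subsolution[OF t, of _ _ "\<lambda>u. m / 3 / u\<^sup>2"])
      fix u assume u: "t \<le> u"
      show "(?b has_real_derivative m / 3 / u\<^sup>2) (at u)"
        using u t by (auto intro!: derivative_eq_intros simp: power2_eq_square field_simps)
      have e: "2 * \<nu> + 1 = m - 1" by (simp add: m_def)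
      have "1 - (?b u)\<^sup>2 - (2 * \<nu> + 1) / u * ?b u - m / 3 / u\<^sup>2 = (1 - m / 3) * (u - t) / u\<^sup>2"
        unfolding e t_def using u t by (simp add: field_simps power2_eq_square)
      moreover have "0 \<le> (1 - m / 3) * (u - t) / u\<^sup>2" using m u by simp
      ultimately show "m / 3 / u\<^sup>2 \<le> 1 - (?b u)\<^sup>2 - (2 * \<nu> + 1) / u * ?b u" by linarith
    qed (use assms in auto)
    moreover have "?b t < bessel_I_ratio \<nu> t" using near[of t] t by (simp add: t_def)
    ultimately obtain E where E: "0 < E" "E * (bessel_I_ratio \<nu> t - ?b t) \<le> bessel_I_ratio \<nu> x - ?b x"
      "?b t < bessel_I_ratio \<nu> t" by blast
    then have "0 < E * (bessel_I_ratio \<nu> t - ?b t)" by simp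
    then show ?thesis using E unfolding m_def by linarith
  qed
qed

section \<open>The modified Bessel function of the second kind\<close>

text \<open>
Euler's integral for the Gamma function after the substitution \<open>t = c exp v\<close>.
\<close>

lemma nn_integral_exp_exp:
  fixes z c :: real
  assumes "0 < z" "0 < c"
  shows "(\<integral>\<^sup>+v. ennreal (exp (z * v - c * exp v)) \<partial>lborel) = ennreal (Gamma z / c powr z)"
proof -
  define f where "f = (\<lambda>t::real. t powr (z - 1) / exp t)"
  have "(f has_integral Gamma z) {0..}"
    unfolding f_def by (rule Gamma_integral_real[OF assms(1)])
  then have f: "(f has_integral Gamma z) {0<..}"
    by (rule has_integral_spike_set_eq[THEN iffD1, rotated -1]) (auto intro!: negligible_subset[OF negligible_sing[of "0::real"]])
  then have "f absolutely_integrable_on {0<..} \<and> integral {0<..} f = Gamma z"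
    by (auto intro!: nonnegative_absolutely_integrable_1 simp: f_def has_integral_iff)
  moreover have "range (\<lambda>v. c * exp v) = {0<..}"
  proof (intro equalityI subsetI)
    fix t :: real assume "t \<in> {0<..}"
    then have "t = c * exp (ln (t / c))" using assms by simp
    then show "t \<in> range (\<lambda>v. c * exp v)" by blast
  qed (use assms in auto)
  ultimately have "(\<lambda>v. \<bar>c * exp v\<bar> * f (c * exp v)) absolutely_integrable_on UNIV \<and>
      integral UNIV (\<lambda>v. \<bar>c * exp v\<bar> * f (c * exp v)) = Gamma z"
    by (subst has_absolute_integral_change_of_variables_1')
      (use assms in \<open>auto intro!: derivative_eq_intros inj_onI\<close>)
  then have "((\<lambda>v. \<bar>c * exp v\<bar> * f (c * exp v)) has_integral Gamma z) UNIV"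
    by (auto simp: has_integral_iff absolutely_integrable_on_def)
  moreover have "\<bar>c * exp v\<bar> * f (c * exp v) = c powr z * exp (z * v - c * exp v)" for v
    using assms by (simp add: f_def powr_mult powr_diff exp_diff exp_powr_real mult_ac)
  ultimately have "((\<lambda>v. c powr z * exp (z * v - c * exp v)) has_integral Gamma z) UNIV" by simp
  from has_integral_divide[OF this, of "c powr z"]
  have "((\<lambda>v. exp (z * v - c * exp v)) has_integral Gamma z / c powr z) UNIV"
    using assms by simp
  then show ?thesis
    using nn_integral_has_integral_lebesgue[of UNIV "\<lambda>v. exp (z * v - c * exp v)"] by simp
qed

lemma bessel_K_uminus: "bessel_K (- \<nu>) x = bessel_K \<nu> x"
  by (simp add: bessel_K_def)

lemma bessel_K_nn_integral_finite:
  assumes "0 < x"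
  shows "(\<integral>\<^sup>+u. ennreal (exp (\<nu> * u - x * cosh u)) \<partial>lborel) < \<infinity>"
proof -
  define z where "z = \<bar>\<nu>\<bar> + 1"
  let ?e = "\<lambda>u. ennreal (exp (z * u - x / 2 * exp u))"
  have fin: "(\<integral>\<^sup>+u. ?e u \<partial>lborel) < \<infinity>"
    using assms by (subst nn_integral_exp_exp) (auto simp: z_def)
  have "(\<integral>\<^sup>+u. ennreal (exp (\<nu> * u - x * cosh u)) \<partial>lborel) \<le> (\<integral>\<^sup>+u. ?e u + ?e (0 + (-1) * u) \<partial>lborel)"
  proof (rule nn_integral_mono)
    fix u :: real
    have "exp (\<nu> * u - x * cosh u) \<le> exp (z * u - x / 2 * exp u) + exp (z * (0 + (-1) * u) - x / 2 * exp (0 + (-1) * u))"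
    proof (cases "0 \<le> u")
      case True
      have "\<nu> * u \<le> z * u" using True by (intro mult_right_mono) (auto simp: z_def)
      moreover have "x / 2 * exp u \<le> x * cosh u" using assms by (simp add: cosh_def)
      ultimately have "exp (\<nu> * u - x * cosh u) \<le> exp (z * u - x / 2 * exp u)" by simp
      then show ?thesis by (smt (verit) exp_gt_zero)
    next
      case False
      have "(- \<nu>) * (- u) \<le> z * (- u)" using False by (intro mult_right_mono) (auto simp: z_def)
      moreover have "x / 2 * exp (- u) \<le> x * cosh u" using assms by (simp add: cosh_def)
      ultimately have "exp (\<nu> * u - x * cosh u) \<le> exp (z * (- u) - x / 2 * exp (- u))" by simp
      then show ?thesis by (smt (verit) exp_gt_zero mult_minus_left mult_1)
    qed
    then show "ennreal (exp (\<nu> * u - x * cosh u)) \<le> ?e u + ?e (0 + (-1) * u)"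
      by (simp flip: ennreal_plus)
  qed
  also have "\<dots> = (\<integral>\<^sup>+u. ?e u \<partial>lborel) + (\<integral>\<^sup>+u. ?e u \<partial>lborel)"
  proof -
    have "(\<integral>\<^sup>+u. ?e u \<partial>lborel) = (\<integral>\<^sup>+u. ?e (0 + (-1) * u) \<partial>lborel)"
      by (subst nn_integral_real_affine[where c = "-1" and t = 0]) auto
    then show ?thesis by (subst nn_integral_add) auto
  qed
  also have "\<dots> < \<infinity>" using fin by (auto simp: ennreal_add_eq_top less_top)
  finally show ?thesis .
qed

text \<open>
Splitting \<open>cosh\<close> into exponentials and reflecting one half gives the integral over the whole line,
which is the form that can be translated.
\<close>

lemma bessel_K_two_sided:
  assumes "0 < x"
  shows "ennreal (2 * bessel_K \<nu> x) = (\<integral>\<^sup>+u. ennreal (exp (\<nu> * u - x * cosh u)) \<partial>lborel)"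
proof -
  let ?e = "\<lambda>u. ennreal (exp (\<nu> * u - x * cosh u))"
  have "(\<integral>\<^sup>+u. ?e u * indicator {..<0} u \<partial>lborel)
      = (\<integral>\<^sup>+u. ?e (- u) * indicator {0<..} u \<partial>lborel)"
    by (subst nn_integral_real_affine[where c = "-1" and t = 0])
      (auto intro!: nn_integral_cong simp: indicator_def cosh_def)
  moreover have "(\<integral>\<^sup>+u. ?e u \<partial>lborel) = (\<integral>\<^sup>+u. ?e u * indicator {0<..} u + ?e u * indicator {..<0} u \<partial>lborel)"
  proof (rule nn_integral_cong_AE)
    show "AE u in lborel. ?e u = ?e u * indicator {0<..} u + ?e u * indicator {..<0} u"
      using AE_lborel_singleton[of "0::real"] by eventually_elim (auto simp: indicator_def)
  qed
  ultimately have "(\<integral>\<^sup>+u. ?e u \<partial>lborel)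
      = (\<integral>\<^sup>+u. ?e u * indicator {0<..} u + ?e (- u) * indicator {0<..} u \<partial>lborel)"
  proof -
    have "(\<integral>\<^sup>+u. ?e u * indicator A u + f u * indicator B u \<partial>lborel)
        = (\<integral>\<^sup>+u. ?e u * indicator A u \<partial>lborel) + (\<integral>\<^sup>+u. f u * indicator B u \<partial>lborel)"
      if [measurable]: "f \<in> borel_measurable borel" "A \<in> sets borel" "B \<in> sets borel" for f and A B :: "real set"
      by (rule nn_integral_add) (simp_all add: cosh_def)
    from this[of ?e "{0<..}" "{..<0}"] this[of "\<lambda>u. ?e (- u)" "{0<..}" "{0<..}"] show ?thesis
      using \<open>(\<integral>\<^sup>+u. ?e u * indicator {..<0} u \<partial>lborel) = _\<close> \<open>(\<integral>\<^sup>+u. ?e u \<partial>lborel) = _\<close>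
      by (simp add: cosh_def)
  qed
  also have "\<dots> = (\<integral>\<^sup>+u. ennreal 2 * ennreal (indicator {0<..} u *\<^sub>R (exp (- x * cosh u) * cosh (\<nu> * u))) \<partial>lborel)"
  proof (intro nn_integral_cong)
    fix u :: real
    have "exp (\<nu> * u - x * cosh u) + exp (\<nu> * (- u) - x * cosh (- u)) = 2 * (exp (- x * cosh u) * cosh (\<nu> * u))"
      by (simp add: cosh_def[of "\<nu> * u"] exp_diff exp_minus field_simps)
    then show "?e u * indicator {0<..} u + ?e (- u) * indicator {0<..} u
        = ennreal 2 * ennreal (indicator {0<..} u *\<^sub>R (exp (- x * cosh u) * cosh (\<nu> * u)))"
      by (auto simp: indicator_def ennreal_mult simp flip: ennreal_plus)
  qed
  also have "\<dots> = ennreal 2 * (\<integral>\<^sup>+u. ennreal (indicator {0<..} u *\<^sub>R (exp (- x * cosh u) * cosh (\<nu> * u))) \<partial>lborel)"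
    by (rule nn_integral_cmult) (simp add: cosh_def)
  finally have eq: "(\<integral>\<^sup>+u. ?e u \<partial>lborel) = \<dots>" .
  have "bessel_K \<nu> x = enn2real (\<integral>\<^sup>+u. ennreal (indicator {0<..} u *\<^sub>R (exp (- x * cosh u) * cosh (\<nu> * u))) \<partial>lborel)"
    unfolding bessel_K_def set_lebesgue_integral_def
    by (rule integral_eq_nn_integral) (auto simp: cosh_def)
  moreover have "(\<integral>\<^sup>+u. ennreal (indicator {0<..} u *\<^sub>R (exp (- x * cosh u) * cosh (\<nu> * u))) \<partial>lborel) < \<infinity>"
    using bessel_K_nn_integral_finite[OF assms, of \<nu>] unfolding eq
    by (auto simp: ennreal_mult_less_top)
  ultimately show ?thesis
    unfolding eq by (simp add: ennreal_mult' less_top)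
qed

lemma bessel_K_nonneg: "0 \<le> bessel_K \<nu> x"
  unfolding bessel_K_def set_lebesgue_integral_def
  by (rule Bochner_Integration.integral_nonneg) auto

lemma borel_measurable_bessel_K [measurable]: "bessel_K \<nu> \<in> borel_measurable borel"
  unfolding bessel_K_def[abs_def] set_lebesgue_integral_def by (simp add: cosh_def) measurable

lemma bessel_K_pos:
  assumes "0 < x"
  shows "0 < bessel_K \<nu> x"
proof (rule ccontr)
  assume "\<not> ?thesis"
  then have "(\<integral>\<^sup>+u. ennreal (exp (\<nu> * u - x * cosh u)) \<partial>lborel) = 0"
    using bessel_K_two_sided[OF assms, of \<nu>] bessel_K_nonneg[of \<nu> x] by simp
  then have "AE u in lborel. ennreal (exp (\<nu> * u - x * cosh u)) = 0"
    by (subst (asm) nn_integral_0_iff_AE) (auto simp: cosh_def)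
  \<comment> \<open>A positive integrand with integral 0 would vanish almost everywhere.\<close>
  then have "AE u::real in lborel. False" by (simp add: ennreal_eq_0_iff)
  then show False by (simp add: eventually_False ae_filter_eq_bot_iff)
qed

lemma bessel_K_mono:
  assumes "0 < x" "\<bar>\<nu>\<bar> \<le> \<bar>\<mu>\<bar>"
  shows "bessel_K \<nu> x \<le> bessel_K \<mu> x"
proof -
  have int: "integrable lborel (\<lambda>u. indicator {0<..} u *\<^sub>R (exp (- x * cosh u) * cosh (\<kappa> * u)))" for \<kappa>
  proof (rule ccontr)
    assume "\<not> ?thesis"
    then have "bessel_K \<kappa> x = 0"
      unfolding bessel_K_def set_lebesgue_integral_def by (rule not_integrable_integral_eq)
    then show False using bessel_K_pos[OF assms(1), of \<kappa>] by simp
  qed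
  show ?thesis
    unfolding bessel_K_def set_lebesgue_integral_def
  proof (intro integral_mono int)
    fix u :: real
    have "\<bar>\<nu> * u\<bar> \<le> \<bar>\<mu> * u\<bar>"
      unfolding abs_mult by (rule mult_right_mono[OF assms(2)]) simp
    then have "cosh \<bar>\<nu> * u\<bar> \<le> cosh \<bar>\<mu> * u\<bar>"
      by (subst cosh_real_nonneg_le_iff) simp_all
    then have "cosh (\<nu> * u) \<le> cosh (\<mu> * u)" by simp
    then show "indicator {0<..} u *\<^sub>R (exp (- x * cosh u) * cosh (\<nu> * u))
        \<le> indicator {0<..} u *\<^sub>R (exp (- x * cosh u) * cosh (\<mu> * u))"
      by (auto simp: indicator_def)
  qed
qed

text \<open>
This is \<open>2 t\<^bsup>\<nu>\<^esup> K\<^bsub>\<nu>\<^esub>(t)\<close> for \<open>t > 0\<close>. In this form the variable \<open>t\<close> occurs only in a Gaussian factor,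
the function is even in \<open>t\<close> and it makes sense at \<open>t = 0\<close>. Values in \<^typ>\<open>ennreal\<close> allow Tonelli's
theorem to be applied directly.
\<close>

definition bessel_K_kernel :: "real \<Rightarrow> real \<Rightarrow> ennreal" where
  "bessel_K_kernel \<nu> t = (\<integral>\<^sup>+v. ennreal (exp (\<nu> * v - exp v / 2 - t\<^sup>2 * exp (- v) / 2)) \<partial>lborel)"

text \<open>
The translation \<open>u = v - ln t\<close> produces the factor \<open>t\<^bsup>-\<nu>\<^esup>\<close> and turns \<open>t cosh u\<close> into
\<open>exp v / 2 + t\<^sup>2 exp (-v) / 2\<close>.
\<close>

lemma bessel_K_eq_kernel:
  assumes "0 < t"
  shows "ennreal (2 * (t powr \<nu> * bessel_K \<nu> t)) = bessel_K_kernel \<nu> t"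
proof -
  have pt: "exp (\<nu> * (- ln t + 1 * v) - t * cosh (- ln t + 1 * v))
      = inverse (t powr \<nu>) * exp (\<nu> * v - exp v / 2 - t\<^sup>2 * exp (- v) / 2)" for v
  proof -
    have "t * cosh (- ln t + 1 * v) = exp v / 2 + t\<^sup>2 * exp (- v) / 2"
      using assms by (simp add: cosh_def exp_diff exp_add exp_minus field_simps power2_eq_square)
    moreover have "exp (\<nu> * v - \<nu> * ln t - (exp v / 2 + t\<^sup>2 * exp (- v) / 2))
        = inverse (exp (\<nu> * ln t)) * exp (\<nu> * v - exp v / 2 - t\<^sup>2 * exp (- v) / 2)"
      by (simp flip: exp_minus exp_add add: algebra_simps)
    ultimately show ?thesis using assms by (simp add: powr_def algebra_simps)
  qed
  have "ennreal (2 * bessel_K \<nu> t) = (\<integral>\<^sup>+u. ennreal (exp (\<nu> * u - t * cosh u)) \<partial>lborel)"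
    by (rule bessel_K_two_sided[OF assms])
  also have "\<dots> = (\<integral>\<^sup>+v. ennreal (exp (\<nu> * (- ln t + 1 * v) - t * cosh (- ln t + 1 * v))) \<partial>lborel)"
    by (subst nn_integral_real_affine[where c = 1 and t = "- ln t"]) (auto simp: cosh_def)
  also have "\<dots> = ennreal (inverse (t powr \<nu>)) * bessel_K_kernel \<nu> t"
    unfolding pt bessel_K_kernel_def by (subst nn_integral_cmult[symmetric]) (auto simp: ennreal_mult)
  finally have "ennreal (t powr \<nu>) * ennreal (2 * bessel_K \<nu> t)
      = (ennreal (t powr \<nu>) * ennreal (inverse (t powr \<nu>))) * bessel_K_kernel \<nu> t"
    by (simp add: mult.assoc)
  moreover have "ennreal (t powr \<nu>) * ennreal (inverse (t powr \<nu>)) = 1"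
    using assms by (simp flip: ennreal_mult)
  moreover have "ennreal (t powr \<nu>) * ennreal (2 * bessel_K \<nu> t) = ennreal (2 * (t powr \<nu> * bessel_K \<nu> t))"
    by (simp add: bessel_K_nonneg mult_ac flip: ennreal_mult)
  ultimately show ?thesis by simp
qed

lemma borel_measurable_bessel_K_kernel [measurable]: "bessel_K_kernel \<nu> \<in> borel_measurable borel"
  unfolding bessel_K_kernel_def[abs_def] by measurable

lemma bessel_K_kernel_0:
  assumes "0 < \<nu>"
  shows "bessel_K_kernel \<nu> 0 = ennreal (2 powr \<nu> * Gamma \<nu>)"
  using nn_integral_exp_exp[of \<nu> "1/2"] assms
  by (simp add: bessel_K_kernel_def powr_divide powr_one_eq_one mult.commute)

text \<open>
After exchanging the integrals, the inner one has the elementary antiderivative of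
\<open>t exp (- t\<^sup>2 exp (-v) / 2)\<close>; the factor \<open>exp v\<close> that it leaves raises the order by one. This
replaces differentiation under the integral sign.
\<close>

lemma nn_integral_kernel_tail:
  assumes "0 \<le> x"
  shows "(\<integral>\<^sup>+t. ennreal t * bessel_K_kernel \<nu> t * indicator {x<..} t \<partial>lborel) = bessel_K_kernel (\<nu> + 1) x"
proof -
  let ?g = "\<lambda>v t. exp (\<nu> * v - exp v / 2 - t\<^sup>2 * exp (- v) / 2)"
  have "(\<integral>\<^sup>+t. ennreal t * bessel_K_kernel \<nu> t * indicator {x<..} t \<partial>lborel)
      = (\<integral>\<^sup>+t. (\<integral>\<^sup>+v. ennreal t * indicator {x<..} t * ennreal (?g v t) \<partial>lborel) \<partial>lborel)"
    unfolding bessel_K_kernel_def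
    by (intro nn_integral_cong, subst nn_integral_cmult) (auto simp: mult_ac)
  also have "\<dots> = (\<integral>\<^sup>+v. (\<integral>\<^sup>+t. ennreal t * indicator {x<..} t * ennreal (?g v t) \<partial>lborel) \<partial>lborel)"
    by (rule lborel_pair.Fubini'[symmetric]) measurable
  also have "\<dots> = (\<integral>\<^sup>+v. ennreal (exp ((\<nu> + 1) * v - exp v / 2 - x\<^sup>2 * exp (- v) / 2)) \<partial>lborel)"
  proof (rule nn_integral_cong)
    fix v :: real
    define F where "F = (\<lambda>t. - exp ((\<nu> + 1) * v - exp v / 2 - t\<^sup>2 * exp (- v) / 2))"
    have "(\<integral>\<^sup>+t. ennreal t * indicator {x<..} t * ennreal (?g v t) \<partial>lborel)
        = (\<integral>\<^sup>+t. ennreal (t * ?g v t) * indicator {x..} t \<partial>lborel)"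
    proof (rule nn_integral_cong_AE)
      show "AE t in lborel. ennreal t * indicator {x<..} t * ennreal (?g v t)
          = ennreal (t * ?g v t) * indicator {x..} t"
        using AE_lborel_singleton[of x]
        by eventually_elim (use assms in \<open>auto simp: indicator_def ennreal_mult\<close>)
    qed
    also have "\<dots> = ennreal (0 - F x)"
    proof (rule nn_integral_FTC_atLeast)
      fix t assume "x \<le> t"
      have "exp ((\<nu> + 1) * v - exp v / 2 - t\<^sup>2 * exp (- v) / 2) * exp (- v) = ?g v t"
        by (simp flip: exp_add add: algebra_simps)
      then show "(F has_real_derivative t * ?g v t) (at t)"
        unfolding F_def by (auto intro!: derivative_eq_intros simp: mult_ac)
      show "0 \<le> t * ?g v t" using \<open>x \<le> t\<close> assms by simp
    next
      have "filterlim (\<lambda>t::real. exp (- v) / 2 * t\<^sup>2) at_top at_top"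
        by (rule filterlim_tendsto_pos_mult_at_top[OF tendsto_const])
          (auto intro!: filterlim_pow_at_top filterlim_ident)
      then have "filterlim (\<lambda>t::real. - ((\<nu> + 1) * v - exp v / 2) + exp (- v) / 2 * t\<^sup>2) at_top at_top"
        by (rule filterlim_tendsto_add_at_top[OF tendsto_const])
      then have "filterlim (\<lambda>t::real. (\<nu> + 1) * v - exp v / 2 - t\<^sup>2 * exp (- v) / 2) at_bot at_top"
        unfolding filterlim_uminus_at_top[symmetric] filterlim_uminus_at_bot by (simp add: algebra_simps)
      then have "((\<lambda>t::real. exp ((\<nu> + 1) * v - exp v / 2 - t\<^sup>2 * exp (- v) / 2)) \<longlongrightarrow> 0) at_top"
        by (rule filterlim_compose[OF exp_at_bot])
      from tendsto_minus[OF this] show "(F \<longlongrightarrow> 0) at_top" by (simp add: F_def)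
    qed measurable
    finally show "(\<integral>\<^sup>+t. ennreal t * indicator {x<..} t * ennreal (?g v t) \<partial>lborel)
        = ennreal (exp ((\<nu> + 1) * v - exp v / 2 - x\<^sup>2 * exp (- v) / 2))" by (simp add: F_def)
  qed
  finally show ?thesis by (simp add: bessel_K_kernel_def)
qed

text \<open>
After exchanging the integrals, the inner one is Gaussian with variance \<open>exp v\<close> and mean
\<open>\<beta> exp v\<close>. Completing the square contributes \<open>exp (\<beta>\<^sup>2 exp v / 2)\<close>, so that the outer one is a Gamma
integral with \<open>1/2\<close> replaced by \<open>(1 - \<beta>\<^sup>2)/2\<close>.
\<close>

lemma nn_integral_exp_kernel:
  assumes "\<mu> > -1/2" "\<bar>\<beta>\<bar> < 1"
  shows "(\<integral>\<^sup>+t. ennreal (exp (\<beta> * t)) * bessel_K_kernel \<mu> t \<partial>lborel)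
     = ennreal (2 * (sqrt pi * 2 powr \<mu> * Gamma (\<mu> + 1/2) / (1 - \<beta>\<^sup>2) powr (\<mu> + 1/2)))"
proof -
  let ?g = "\<lambda>v t. exp (\<mu> * v - exp v / 2 - t\<^sup>2 * exp (- v) / 2)"
  have \<beta>: "0 < 1 - \<beta>\<^sup>2" using assms by (simp add: abs_square_less_1)
  have "(\<integral>\<^sup>+t. ennreal (exp (\<beta> * t)) * bessel_K_kernel \<mu> t \<partial>lborel)
      = (\<integral>\<^sup>+t. (\<integral>\<^sup>+v. ennreal (exp (\<beta> * t)) * ennreal (?g v t) \<partial>lborel) \<partial>lborel)"
    unfolding bessel_K_kernel_def
    by (intro nn_integral_cong, subst nn_integral_cmult) auto
  also have "\<dots> = (\<integral>\<^sup>+v. (\<integral>\<^sup>+t. ennreal (exp (\<beta> * t)) * ennreal (?g v t) \<partial>lborel) \<partial>lborel)"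
    by (rule lborel_pair.Fubini'[symmetric]) measurable
  also have "\<dots> = (\<integral>\<^sup>+v. ennreal (sqrt (2 * pi)) * ennreal (exp ((\<mu> + 1/2) * v - (1 - \<beta>\<^sup>2) / 2 * exp v)) \<partial>lborel)"
  proof (rule nn_integral_cong)
    fix v :: real
    define \<sigma> where "\<sigma> = exp (v / 2)"
    have \<sigma>: "0 < \<sigma>" "\<sigma>\<^sup>2 = exp v" "exp (- v) = 1 / \<sigma>\<^sup>2"
      by (simp_all add: \<sigma>_def power2_eq_square exp_minus inverse_eq_divide flip: exp_add)
    have pt: "exp (\<beta> * t) * ?g v t
        = (sqrt (2 * pi) * exp ((\<mu> + 1/2) * v - (1 - \<beta>\<^sup>2) / 2 * exp v)) * normal_density (\<beta> * \<sigma>\<^sup>2) \<sigma> t" for t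
    proof -
      have "normal_density (\<beta> * \<sigma>\<^sup>2) \<sigma> t = exp (- (t - \<beta> * \<sigma>\<^sup>2)\<^sup>2 / (2 * \<sigma>\<^sup>2)) / (sqrt (2 * pi) * \<sigma>)"
        using \<sigma>(1) by (simp add: normal_density_def real_sqrt_mult)
      then have "(sqrt (2 * pi) * exp ((\<mu> + 1/2) * v - (1 - \<beta>\<^sup>2) / 2 * exp v)) * normal_density (\<beta> * \<sigma>\<^sup>2) \<sigma> t
         = exp ((\<mu> + 1/2) * v - (1 - \<beta>\<^sup>2) / 2 * exp v) * exp (- (t - \<beta> * \<sigma>\<^sup>2)\<^sup>2 / (2 * \<sigma>\<^sup>2)) / \<sigma>"
        by simp
      also have "\<dots> = exp ((\<mu> + 1/2) * v - (1 - \<beta>\<^sup>2) / 2 * exp v + - (t - \<beta> * \<sigma>\<^sup>2)\<^sup>2 / (2 * \<sigma>\<^sup>2) - v / 2)"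
        by (simp only: exp_diff[of _ "v / 2"] exp_add \<sigma>_def)
      also have "(\<mu> + 1/2) * v - (1 - \<beta>\<^sup>2) / 2 * exp v + - (t - \<beta> * \<sigma>\<^sup>2)\<^sup>2 / (2 * \<sigma>\<^sup>2) - v / 2
          = \<beta> * t + (\<mu> * v - exp v / 2 - t\<^sup>2 * exp (- v) / 2)"
        unfolding \<sigma>(2)[symmetric] \<sigma>(3) using \<sigma>(1) by (simp add: field_simps power2_eq_square)
      finally show ?thesis by (simp add: exp_add)
    qed
    have "(\<integral>\<^sup>+t. ennreal (exp (\<beta> * t)) * ennreal (?g v t) \<partial>lborel)
        = (\<integral>\<^sup>+t. ennreal (sqrt (2 * pi) * exp ((\<mu> + 1/2) * v - (1 - \<beta>\<^sup>2) / 2 * exp v))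
            * ennreal (normal_density (\<beta> * \<sigma>\<^sup>2) \<sigma> t) \<partial>lborel)"
      by (intro nn_integral_cong) (simp add: pt flip: ennreal_mult)
    also have "\<dots> = ennreal (sqrt (2 * pi) * exp ((\<mu> + 1/2) * v - (1 - \<beta>\<^sup>2) / 2 * exp v))"
      using \<sigma>(1) by (subst nn_integral_cmult) (auto simp: nn_integral_eq_integral normal_density_nonneg)
    finally show "(\<integral>\<^sup>+t. ennreal (exp (\<beta> * t)) * ennreal (?g v t) \<partial>lborel)
        = ennreal (sqrt (2 * pi)) * ennreal (exp ((\<mu> + 1/2) * v - (1 - \<beta>\<^sup>2) / 2 * exp v))"
      by (simp add: ennreal_mult)
  qed
  also have "\<dots> = ennreal (sqrt (2 * pi)) * ennreal (Gamma (\<mu> + 1/2) / ((1 - \<beta>\<^sup>2) / 2) powr (\<mu> + 1/2))"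
    using nn_integral_exp_exp[of "\<mu> + 1/2" "(1 - \<beta>\<^sup>2) / 2"] assms \<beta> by (simp add: nn_integral_cmult)
  also have "\<dots> = ennreal (2 * (sqrt pi * 2 powr \<mu> * Gamma (\<mu> + 1/2) / (1 - \<beta>\<^sup>2) powr (\<mu> + 1/2)))"
  proof -
    have "sqrt 2 * 2 powr (\<mu> + 1/2) = 2 * 2 powr \<mu>"
      by (simp add: powr_add powr_half_sqrt)
    then have "sqrt (2 * pi) * (Gamma (\<mu> + 1/2) / ((1 - \<beta>\<^sup>2) / 2) powr (\<mu> + 1/2))
        = 2 * (sqrt pi * 2 powr \<mu> * Gamma (\<mu> + 1/2) / (1 - \<beta>\<^sup>2) powr (\<mu> + 1/2))"
      using \<beta> by (simp add: powr_divide real_sqrt_mult mult_ac)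
    then show ?thesis using assms by (simp flip: ennreal_mult')
  qed
  finally show ?thesis .
qed

section \<open>Calculus of K\<close>

lemma bessel_K_tail_of_kernel:
  assumes "0 \<le> x" "0 \<le> r" "bessel_K_kernel (\<nu> + 1) x = ennreal (2 * r)"
  shows "set_integrable lborel {x<..} (\<lambda>t. t powr (\<nu> + 1) * bessel_K \<nu> t) \<and>
    (LBINT t:{x<..}. t powr (\<nu> + 1) * bessel_K \<nu> t) = r"
proof -
  let ?f = "\<lambda>t. indicator {x<..} t *\<^sub>R (t powr (\<nu> + 1) * bessel_K \<nu> t)"
  have "ennreal 2 * (\<integral>\<^sup>+t. ennreal (?f t) \<partial>lborel) = (\<integral>\<^sup>+t. ennreal 2 * ennreal (?f t) \<partial>lborel)"
    by (subst nn_integral_cmult) auto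
  also have "\<dots> = (\<integral>\<^sup>+t. ennreal t * bessel_K_kernel \<nu> t * indicator {x<..} t \<partial>lborel)"
  proof (rule nn_integral_cong)
    fix t :: real
    have "ennreal 2 * ennreal (t powr (\<nu> + 1) * bessel_K \<nu> t) = ennreal t * bessel_K_kernel \<nu> t" if "0 < t"
    proof -
      have "ennreal t * bessel_K_kernel \<nu> t = ennreal (t * (2 * (t powr \<nu> * bessel_K \<nu> t)))"
        using that by (simp add: bessel_K_eq_kernel[symmetric] bessel_K_nonneg ennreal_mult)
      also have "t * (2 * (t powr \<nu> * bessel_K \<nu> t)) = 2 * (t powr (\<nu> + 1) * bessel_K \<nu> t)"
        using that by (simp add: powr_add)
      finally show ?thesis by (simp add: bessel_K_nonneg ennreal_mult)
    qed
    then show "ennreal 2 * ennreal (?f t) = ennreal t * bessel_K_kernel \<nu> t * indicator {x<..} t"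
      using \<open>0 \<le> x\<close> by (auto simp: indicator_def)
  qed
  also have "\<dots> = ennreal 2 * ennreal r"
    using assms by (simp add: nn_integral_kernel_tail ennreal_mult)
  finally have "(\<integral>\<^sup>+t. ennreal (?f t) \<partial>lborel) = ennreal r"
    by (subst (asm) ennreal_mult_cancel_left) auto
  then have "integrable lborel ?f \<and> integral\<^sup>L lborel ?f = r"
    by (subst (asm) nn_integral_eq_integrable) (auto simp: bessel_K_nonneg \<open>0 \<le> r\<close>)
  then show ?thesis by (simp add: set_integrable_def set_lebesgue_integral_def)
qed

lemma bessel_K_tail:
  assumes "0 < x"
  shows "set_integrable lborel {x<..} (\<lambda>t. t powr (\<nu> + 1) * bessel_K \<nu> t)"
    and "(LBINT t:{x<..}. t powr (\<nu> + 1) * bessel_K \<nu> t) = x powr (\<nu> + 1) * bessel_K (\<nu> + 1) x"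
  using bessel_K_tail_of_kernel[of x "x powr (\<nu> + 1) * bessel_K (\<nu> + 1) x" \<nu>] assms
  by (auto simp: bessel_K_eq_kernel bessel_K_nonneg)

lemma bessel_K_moment:
  assumes "\<nu> > -1"
  shows "set_integrable lborel {0<..} (\<lambda>t. t powr (\<nu> + 1) * bessel_K \<nu> t)"
    and "(LBINT t:{0<..}. t powr (\<nu> + 1) * bessel_K \<nu> t) = 2 powr \<nu> * Gamma (\<nu> + 1)"
  using bessel_K_tail_of_kernel[of 0 "2 powr \<nu> * Gamma (\<nu> + 1)" \<nu>] assms Gamma_real_pos[of "\<nu> + 1"]
  by (auto simp: bessel_K_kernel_0 powr_add mult_ac)

text \<open>
Every \<open>K\<^bsub>\<nu>\<^esub>\<close> is a power times a tail integral, which yields continuity first and then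
differentiability.
\<close>

lemma bessel_K_eq_tail:
  assumes "0 < x"
  shows "bessel_K \<nu> x = x powr (- \<nu>) * (LBINT t:{x<..}. t powr \<nu> * bessel_K (\<nu> - 1) t)"
  using bessel_K_tail(2)[OF assms, of "\<nu> - 1"] assms by (simp add: powr_minus)

lemma isCont_bessel_K:
  assumes "0 < x"
  shows "isCont (bessel_K \<nu>) x"
proof -
  have "isCont (\<lambda>x. LBINT t:{x<..}. t powr \<nu> * bessel_K (\<nu> - 1) t) x"
    using tail_integral_isCont[OF bessel_K_tail(1)[of "x / 2" "\<nu> - 1"]] assms by simp
  then have "isCont (\<lambda>x. x powr (- \<nu>) * (LBINT t:{x<..}. t powr \<nu> * bessel_K (\<nu> - 1) t)) x"
    using assms by (intro continuous_intros) auto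
  moreover have "eventually (\<lambda>y. bessel_K \<nu> y = y powr (- \<nu>) * (LBINT t:{y<..}. t powr \<nu> * bessel_K (\<nu> - 1) t)) (nhds x)"
    using eventually_nhds_in_open[of "{0<..}" x] assms
    by (auto elim!: eventually_mono intro: bessel_K_eq_tail)
  ultimately show ?thesis by (simp add: isCont_cong)
qed

lemma continuous_on_bessel_K: "continuous_on {0<..} (bessel_K \<nu>)"
  by (intro continuous_at_imp_continuous_on ballI isCont_bessel_K) auto

lemma bessel_K_deriv:
  assumes "0 < x"
  shows "(bessel_K \<nu> has_real_derivative - bessel_K (\<nu> - 1) x - \<nu> / x * bessel_K \<nu> x) (at x)"
proof -
  let ?T = "\<lambda>x. LBINT t:{x<..}. t powr \<nu> * bessel_K (\<nu> - 1) t"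
  have "continuous_on {x/2<..} (\<lambda>t. t powr \<nu> * bessel_K (\<nu> - 1) t)"
    using assms by (intro continuous_intros continuous_on_subset[OF continuous_on_bessel_K]) auto
  then have "(?T has_real_derivative - (x powr \<nu> * bessel_K (\<nu> - 1) x)) (at x)"
    using bessel_K_tail(1)[of "x / 2" "\<nu> - 1"] assms by (intro tail_integral_deriv[of "x / 2"]) auto
  moreover have "((\<lambda>x. x powr (- \<nu>)) has_real_derivative - \<nu> * x powr (- \<nu> - 1)) (at x)"
    using assms by (auto intro!: derivative_eq_intros)
  ultimately have "((\<lambda>x. x powr (- \<nu>) * ?T x) has_real_derivative
      - \<nu> * x powr (- \<nu> - 1) * ?T x + - (x powr \<nu> * bessel_K (\<nu> - 1) x) * x powr (- \<nu>)) (at x)"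
    by (intro DERIV_mult)
  moreover have "- \<nu> * x powr (- \<nu> - 1) * ?T x + - (x powr \<nu> * bessel_K (\<nu> - 1) x) * x powr (- \<nu>)
      = - bessel_K (\<nu> - 1) x - \<nu> / x * bessel_K \<nu> x"
    using assms by (simp add: bessel_K_eq_tail[of x \<nu>] powr_diff powr_minus field_simps)
  ultimately have "((\<lambda>x. x powr (- \<nu>) * ?T x) has_real_derivative
      - bessel_K (\<nu> - 1) x - \<nu> / x * bessel_K \<nu> x) (at x)" by simp
  then show ?thesis
    by (rule has_field_derivative_transform_within_open[where S = "{0<..}"])
      (use assms bessel_K_eq_tail in auto)
qed

text \<open>
The companion of the previous formula, obtained from the symmetry \<open>K\<^bsub>-\<nu>\<^esub> = K\<^bsub>\<nu>\<^esub>\<close>.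
\<close>

lemma bessel_K_deriv':
  assumes "0 < x"
  shows "(bessel_K \<nu> has_real_derivative - bessel_K (\<nu> + 1) x + \<nu> / x * bessel_K \<nu> x) (at x)"
proof -
  have "bessel_K (- \<nu>) = bessel_K \<nu>" "bessel_K (- \<nu> - 1) = bessel_K (\<nu> + 1)"
    using bessel_K_uminus[of \<nu>] bessel_K_uminus[of "\<nu> + 1"] by (auto simp: fun_eq_iff)
  then show ?thesis using bessel_K_deriv[OF assms, of "- \<nu>"] by simp
qed

text \<open>
By the tail formula the limit is a full moment of \<open>K\<^bsub>\<mu>-1\<^esub>\<close>.
\<close>

lemma bessel_K_at_right_0:
  assumes "0 < \<mu>"
  shows "((\<lambda>x. x powr \<mu> * bessel_K \<mu> x) \<longlongrightarrow> 2 powr (\<mu> - 1) * Gamma \<mu>) (at_right 0)"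
proof -
  have "((\<lambda>x. LBINT t:{x<..}. t powr \<mu> * bessel_K (\<mu> - 1) t) \<longlongrightarrow> 2 powr (\<mu> - 1) * Gamma \<mu>) (at_right 0)"
    using tail_integral_at_right_0[OF bessel_K_moment(1)[of "\<mu> - 1"]] bessel_K_moment(2)[of "\<mu> - 1"] assms by simp
  moreover have "eventually (\<lambda>x. (LBINT t:{x<..}. t powr \<mu> * bessel_K (\<mu> - 1) t) = x powr \<mu> * bessel_K \<mu> x) (at_right 0)"
    using eventually_at_right_less[of 0]
    by eventually_elim (use bessel_K_tail(2)[of _ "\<mu> - 1"] in simp)
  ultimately show ?thesis by (simp add: tendsto_cong)
qed

section \<open>Exponentially weighted tail integrals of K\<close>

lemma set_integral_pos:
  fixes f :: "real \<Rightarrow> real"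
  assumes "set_integrable lborel {x<..} f" "\<And>t. x < t \<Longrightarrow> 0 < f t"
  shows "0 < (LBINT t:{x<..}. f t)"
proof -
  let ?g = "\<lambda>t. indicator {x<..} t *\<^sub>R f t"
  have g: "integrable lborel ?g" "AE t in lborel. 0 \<le> ?g t"
    using assms by (auto simp: set_integrable_def indicator_def less_imp_le)
  have "integral\<^sup>L lborel ?g \<noteq> 0"
  proof
    assume "integral\<^sup>L lborel ?g = 0"
    then have "AE t in lborel. ?g t = 0"
      using g by (simp add: integral_nonneg_eq_0_iff_AE)
    then have "AE t in lborel. t \<notin> {x<..}"
      by eventually_elim (use assms(2) in \<open>fastforce simp: indicator_def split: if_splits\<close>)
    then have "emeasure lborel {x<..} = 0"
      by (subst (asm) AE_iff_measurable[where N = "{x<..}"]) auto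
    moreover have "emeasure lborel {x+1..x+2} \<le> emeasure lborel {x<..}"
      by (intro emeasure_mono) auto
    ultimately show False by simp
  qed
  then show ?thesis
    using Bochner_Integration.integral_nonneg_AE[OF g(2)] by (simp add: set_lebesgue_integral_def)
qed

text \<open>
The integrals over the half line for \<open>\<beta>\<close> and \<open>-\<beta>\<close> add up to the integral over the whole line,
because the kernel is even. The one for \<open>-\<beta>\<close> is positive, whence the strict inequality.
\<close>

lemma bessel_K_laplace_less:
  assumes "\<mu> > -1/2" "\<bar>\<beta>\<bar> < 1"
  shows "set_integrable lborel {0<..} (\<lambda>t. exp (\<beta> * t) * (t powr \<mu> * bessel_K \<mu> t))"
    and "(LBINT t:{0<..}. exp (\<beta> * t) * (t powr \<mu> * bessel_K \<mu> t))
      < sqrt pi * 2 powr \<mu> * Gamma (\<mu> + 1/2) / (1 - \<beta>\<^sup>2) powr (\<mu> + 1/2)"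
proof -
  define G where "G = sqrt pi * 2 powr \<mu> * Gamma (\<mu> + 1/2) / (1 - \<beta>\<^sup>2) powr (\<mu> + 1/2)"
  have G: "0 \<le> G" using assms Gamma_real_pos[of "\<mu> + 1/2"] by (simp add: G_def)
  let ?f = "\<lambda>\<beta> t. indicator {0<..} t *\<^sub>R (exp (\<beta> * t) * (t powr \<mu> * bessel_K \<mu> t))"
  let ?k = "\<lambda>\<beta> t. ennreal (exp (\<beta> * t)) * bessel_K_kernel \<mu> t"
  have nonneg: "0 \<le> ?f \<beta> t" for \<beta> t by (simp add: bessel_K_nonneg)
  have sum_nonneg: "0 \<le> ?f \<beta> t + ?f (- \<beta>) t" for t
    by (rule add_nonneg_nonneg[OF nonneg nonneg])
  have half: "?k \<gamma> t * indicator {0<..} t = ennreal 2 * ennreal (?f \<gamma> t)" for \<gamma> t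
  proof (cases "0 < t")
    case True
    then show ?thesis
      by (simp add: bessel_K_eq_kernel[symmetric] bessel_K_nonneg ennreal_mult mult_ac)
  qed simp
  have even: "bessel_K_kernel \<mu> (- t) = bessel_K_kernel \<mu> t" for t
    by (simp add: bessel_K_kernel_def)
  have "ennreal 2 * ennreal G = (\<integral>\<^sup>+t. ?k \<beta> t \<partial>lborel)"
    using nn_integral_exp_kernel[OF assms] G unfolding G_def by (subst ennreal_mult[symmetric]) auto
  also have "\<dots> = (\<integral>\<^sup>+t. ?k \<beta> t * indicator {0<..} t + ?k \<beta> t * indicator {..<0} t \<partial>lborel)"
  proof (rule nn_integral_cong_AE)
    show "AE t in lborel. ?k \<beta> t = ?k \<beta> t * indicator {0<..} t + ?k \<beta> t * indicator {..<0} t"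
      using AE_lborel_singleton[of "0::real"] by eventually_elim (auto simp: indicator_def)
  qed
  also have "\<dots> = (\<integral>\<^sup>+t. ?k \<beta> t * indicator {0<..} t \<partial>lborel) + (\<integral>\<^sup>+t. ?k \<beta> t * indicator {..<0} t \<partial>lborel)"
    by (rule nn_integral_add) auto
  also have "(\<integral>\<^sup>+t. ?k \<beta> t * indicator {..<0} t \<partial>lborel) = (\<integral>\<^sup>+t. ?k (- \<beta>) t * indicator {0<..} t \<partial>lborel)"
    by (subst nn_integral_real_affine[where c = "-1" and t = 0])
      (auto intro!: nn_integral_cong simp: indicator_def even)
  also have "(\<integral>\<^sup>+t. ?k \<beta> t * indicator {0<..} t \<partial>lborel) + (\<integral>\<^sup>+t. ?k (- \<beta>) t * indicator {0<..} t \<partial>lborel)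
      = (\<integral>\<^sup>+t. ennreal 2 * ennreal (?f \<beta> t) + ennreal 2 * ennreal (?f (- \<beta>) t) \<partial>lborel)"
    unfolding half by (rule nn_integral_add[symmetric]) auto
  also have "\<dots> = (\<integral>\<^sup>+t. ennreal 2 * ennreal (?f \<beta> t + ?f (- \<beta>) t) \<partial>lborel)"
    by (intro nn_integral_cong) (simp only: ennreal_plus[OF nonneg nonneg] distrib_left)
  also have "\<dots> = ennreal 2 * (\<integral>\<^sup>+t. ennreal (?f \<beta> t + ?f (- \<beta>) t) \<partial>lborel)"
    by (rule nn_integral_cmult) auto
  finally have "(\<integral>\<^sup>+t. ennreal (?f \<beta> t + ?f (- \<beta>) t) \<partial>lborel) = ennreal G"
    by (subst (asm) ennreal_mult_cancel_left) auto
  then have sum: "integrable lborel (\<lambda>t. ?f \<beta> t + ?f (- \<beta>) t)" "integral\<^sup>L lborel (\<lambda>t. ?f \<beta> t + ?f (- \<beta>) t) = G"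
    using sum_nonneg by (subst (asm) nn_integral_eq_integrable; use G in simp)+
  have int: "integrable lborel (?f \<beta>)" "integrable lborel (?f (- \<beta>))"
    by (rule Bochner_Integration.integrable_bound[OF sum(1)];
        auto simp: indicator_def bessel_K_nonneg)+
  then show "set_integrable lborel {0<..} (\<lambda>t. exp (\<beta> * t) * (t powr \<mu> * bessel_K \<mu> t))"
    by (simp add: set_integrable_def)
  have "0 < (LBINT t:{0<..}. exp (- \<beta> * t) * (t powr \<mu> * bessel_K \<mu> t))"
    by (rule set_integral_pos) (use int(2) in \<open>auto simp: set_integrable_def bessel_K_pos\<close>)
  moreover have "G = (LBINT t:{0<..}. exp (\<beta> * t) * (t powr \<mu> * bessel_K \<mu> t))
      + (LBINT t:{0<..}. exp (- \<beta> * t) * (t powr \<mu> * bessel_K \<mu> t))"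
    unfolding set_lebesgue_integral_def sum(2)[symmetric] by (rule Bochner_Integration.integral_add[OF int])
  ultimately show "(LBINT t:{0<..}. exp (\<beta> * t) * (t powr \<mu> * bessel_K \<mu> t))
      < sqrt pi * 2 powr \<mu> * Gamma (\<mu> + 1/2) / (1 - \<beta>\<^sup>2) powr (\<mu> + 1/2)"
    unfolding G_def by linarith
qed

lemma bessel_K_laplace_integrable:
  assumes "\<mu> > -1/2" "\<beta> < 1"
  shows "set_integrable lborel {0<..} (\<lambda>t. exp (\<beta> * t) * (t powr \<mu> * bessel_K \<mu> t))"
proof -
  define \<gamma> where "\<gamma> = max \<beta> 0"
  have "set_integrable lborel {0<..} (\<lambda>t. exp (\<gamma> * t) * (t powr \<mu> * bessel_K \<mu> t))"
    using assms by (intro bessel_K_laplace_less) (auto simp: \<gamma>_def)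
  then show ?thesis
    unfolding set_integrable_def
  proof (rule Bochner_Integration.integrable_bound)
    show "AE t in lborel. norm (indicator {0<..} t *\<^sub>R (exp (\<beta> * t) * (t powr \<mu> * bessel_K \<mu> t)))
        \<le> norm (indicator {0<..} t *\<^sub>R (exp (\<gamma> * t) * (t powr \<mu> * bessel_K \<mu> t)))"
      by (intro AE_I2)
        (auto simp: indicator_def \<gamma>_def abs_mult bessel_K_nonneg intro!: mult_right_mono)
  qed simp
qed

lemma bessel_K_laplace_integrable_raised:
  assumes "\<nu> > -1/2" "\<beta> < 1"
  shows "set_integrable lborel {0<..} (\<lambda>t. exp (\<beta> * t) * (t powr (\<nu> + 1) * bessel_K \<nu> t))"
proof -
  have "set_integrable lborel {0<..} (\<lambda>t. exp (\<beta> * t) * (t powr (\<nu> + 1) * bessel_K (\<nu> + 1) t))"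
    using assms by (intro bessel_K_laplace_integrable) auto
  then show ?thesis
    unfolding set_integrable_def
  proof (rule Bochner_Integration.integrable_bound)
    show "AE t in lborel. norm (indicator {0<..} t *\<^sub>R (exp (\<beta> * t) * (t powr (\<nu> + 1) * bessel_K \<nu> t)))
        \<le> norm (indicator {0<..} t *\<^sub>R (exp (\<beta> * t) * (t powr (\<nu> + 1) * bessel_K (\<nu> + 1) t)))"
      using assms by (intro AE_I2)
        (auto simp: indicator_def abs_mult bessel_K_nonneg intro!: mult_left_mono bessel_K_mono)
  qed simp
qed

text \<open>
By the tail formula for \<open>K\<^bsub>\<nu>+1\<^esub>\<close> the function is dominated by the tail of a convergent integral.
\<close>

lemma exp_bessel_K_at_top:
  assumes "\<nu> > -1/2" "\<beta> < 1"
  shows "((\<lambda>x. exp (\<beta> * x) * (x powr (\<nu> + 1) * bessel_K (\<nu> + 1) x)) \<longlongrightarrow> 0) at_top"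
proof (rule tendsto_sandwich[of "\<lambda>_. 0"])
  define \<gamma> where "\<gamma> = max \<beta> 0"
  have int: "set_integrable lborel {0<..} (\<lambda>t. exp (\<gamma> * t) * (t powr (\<nu> + 1) * bessel_K \<nu> t))"
    using assms by (intro bessel_K_laplace_integrable_raised) (auto simp: \<gamma>_def)
  then show "((\<lambda>x. LBINT t:{x<..}. exp (\<gamma> * t) * (t powr (\<nu> + 1) * bessel_K \<nu> t)) \<longlongrightarrow> 0) at_top"
    by (rule tail_integral_at_top)
  show "eventually (\<lambda>x. exp (\<beta> * x) * (x powr (\<nu> + 1) * bessel_K (\<nu> + 1) x)
      \<le> (LBINT t:{x<..}. exp (\<gamma> * t) * (t powr (\<nu> + 1) * bessel_K \<nu> t))) at_top"
    using eventually_gt_at_top[of 0]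
  proof eventually_elim
    fix x :: real assume x: "0 < x"
    have "exp (\<beta> * x) * (x powr (\<nu> + 1) * bessel_K (\<nu> + 1) x)
        = (LBINT t:{x<..}. exp (\<beta> * x) * (t powr (\<nu> + 1) * bessel_K \<nu> t))"
      using bessel_K_tail(2)[OF x, of \<nu>] by simp
    also have "\<dots> \<le> (LBINT t:{x<..}. exp (\<gamma> * t) * (t powr (\<nu> + 1) * bessel_K \<nu> t))"
    proof (rule set_integral_mono)
      show "set_integrable lborel {x<..} (\<lambda>t. exp (\<beta> * x) * (t powr (\<nu> + 1) * bessel_K \<nu> t))"
        using bessel_K_tail(1)[OF x, of \<nu>] by simp
      show "set_integrable lborel {x<..} (\<lambda>t. exp (\<gamma> * t) * (t powr (\<nu> + 1) * bessel_K \<nu> t))"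
        by (rule set_integrable_subset[OF int]) (use x in auto)
      fix t assume "t \<in> {x<..}"
      then have "\<beta> * x \<le> \<gamma> * t" using x by (intro mult_mono) (auto simp: \<gamma>_def)
      then show "exp (\<beta> * x) * (t powr (\<nu> + 1) * bessel_K \<nu> t) \<le> exp (\<gamma> * t) * (t powr (\<nu> + 1) * bessel_K \<nu> t)"
        by (intro mult_right_mono) (auto simp: bessel_K_nonneg)
    qed
    finally show "exp (\<beta> * x) * (x powr (\<nu> + 1) * bessel_K (\<nu> + 1) x)
      \<le> (LBINT t:{x<..}. exp (\<gamma> * t) * (t powr (\<nu> + 1) * bessel_K \<nu> t))" .
  qed
qed (auto simp: bessel_K_nonneg intro!: always_eventually)

lemma exp_bessel_K_deriv:
  assumes "0 < x"
  shows "((\<lambda>x. exp (\<beta> * x) * (x powr (\<nu> + 1) * bessel_K (\<nu> + 1) x)) has_real_derivative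
     \<beta> * (exp (\<beta> * x) * (x powr (\<nu> + 1) * bessel_K (\<nu> + 1) x))
     - exp (\<beta> * x) * (x powr (\<nu> + 1) * bessel_K \<nu> x)) (at x)"
proof -
  have K: "(bessel_K (\<nu> + 1) has_real_derivative - bessel_K \<nu> x - (\<nu> + 1) / x * bessel_K (\<nu> + 1) x) (at x)"
    using bessel_K_deriv[OF assms, of "\<nu> + 1"] by simp
  have "((\<lambda>x. x powr (\<nu> + 1)) has_real_derivative (\<nu> + 1) * x powr \<nu>) (at x)"
    using assms by (auto intro!: derivative_eq_intros)
  from DERIV_mult[OF this K]
  have "((\<lambda>x. x powr (\<nu> + 1) * bessel_K (\<nu> + 1) x) has_real_derivative - (x powr (\<nu> + 1) * bessel_K \<nu> x)) (at x)"
    by (rule DERIV_cong) (use assms in \<open>simp add: powr_add field_simps\<close>)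
  moreover have "((\<lambda>x. exp (\<beta> * x)) has_real_derivative \<beta> * exp (\<beta> * x)) (at x)"
    by (auto intro!: derivative_eq_intros)
  ultimately have "((\<lambda>x. exp (\<beta> * x) * (x powr (\<nu> + 1) * bessel_K (\<nu> + 1) x)) has_real_derivative
     \<beta> * exp (\<beta> * x) * (x powr (\<nu> + 1) * bessel_K (\<nu> + 1) x) + - (x powr (\<nu> + 1) * bessel_K \<nu> x) * exp (\<beta> * x)) (at x)"
    by (intro DERIV_mult)
  then show ?thesis by (rule DERIV_cong) (simp add: algebra_simps)
qed

lemma exp_bessel_K_tail_deriv:
  assumes "0 < x" "set_integrable lborel {0<..} (\<lambda>t. exp (\<beta> * t) * (t powr p * bessel_K \<mu> t))"
  shows "((\<lambda>x. LBINT t:{x<..}. exp (\<beta> * t) * (t powr p * bessel_K \<mu> t)) has_real_derivative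
     - (exp (\<beta> * x) * (x powr p * bessel_K \<mu> x))) (at x)"
  using assms
  by (intro tail_integral_deriv[of 0] continuous_intros continuous_on_bessel_K) auto

text \<open>
The two sides have the same derivative and both tend to 0 at infinity.
\<close>

lemma bessel_K_integration_by_parts:
  assumes "0 < x" "\<nu> > -1/2" "\<beta> < 1"
  shows "(LBINT t:{x<..}. exp (\<beta> * t) * (t powr (\<nu> + 1) * bessel_K \<nu> t))
    = exp (\<beta> * x) * (x powr (\<nu> + 1) * bessel_K (\<nu> + 1) x)
      + \<beta> * (LBINT t:{x<..}. exp (\<beta> * t) * (t powr (\<nu> + 1) * bessel_K (\<nu> + 1) t))"
proof -
  let ?h = "\<lambda>x. exp (\<beta> * x) * (x powr (\<nu> + 1) * bessel_K (\<nu> + 1) x)"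
  let ?A = "\<lambda>x. LBINT t:{x<..}. exp (\<beta> * t) * (t powr (\<nu> + 1) * bessel_K \<nu> t)"
  let ?B = "\<lambda>x. LBINT t:{x<..}. ?h t"
  let ?\<Psi> = "\<lambda>x. ?A x - ?h x - \<beta> * ?B x"
  have A: "set_integrable lborel {0<..} (\<lambda>t. exp (\<beta> * t) * (t powr (\<nu> + 1) * bessel_K \<nu> t))"
    using assms by (intro bessel_K_laplace_integrable_raised) auto
  have B: "set_integrable lborel {0<..} ?h"
    using assms by (intro bessel_K_laplace_integrable) auto
  have "(?\<Psi> \<longlongrightarrow> 0 - 0 - \<beta> * 0) at_top"
    using assms by (intro tendsto_intros tail_integral_at_top[OF A] tail_integral_at_top[OF B] exp_bessel_K_at_top)
  moreover have const: "?\<Psi> y = ?\<Psi> x" if "x \<le> y" for y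
  proof (rule DERIV_isconst2[of x "y + 1"])
    have der: "(?\<Psi> has_real_derivative 0) (at t)" if "x \<le> t" for t
    proof -
      have t: "0 < t" using that assms by simp
      show ?thesis
        by (rule DERIV_cong[OF DERIV_diff[OF DERIV_diff[OF exp_bessel_K_tail_deriv[OF t A]
              exp_bessel_K_deriv[OF t]] DERIV_cmult[OF exp_bessel_K_tail_deriv[OF t B]]]]) simp
    qed
    then show "continuous_on {x..y+1} ?\<Psi>"
      by (intro continuous_at_imp_continuous_on ballI DERIV_isCont) auto
    show "(?\<Psi> has_real_derivative 0) (at t)" if "x < t" "t < y + 1" for t
      using der[of t] that by simp
  qed (use that in auto)
  then have "eventually (\<lambda>y. ?\<Psi> y = ?\<Psi> x) at_top"
    by (intro eventually_mono[OF eventually_ge_at_top[of x]] const)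
  ultimately have "((\<lambda>_. ?\<Psi> x) \<longlongrightarrow> 0) (at_top :: real filter)"
    by (simp add: tendsto_cong)
  then have "?\<Psi> x = 0" by (simp add: tendsto_const_iff)
  then show ?thesis by simp
qed

definition bessel_K_ratio :: "real \<Rightarrow> real \<Rightarrow> real" where
  "bessel_K_ratio \<nu> x = bessel_K \<nu> x / bessel_K (\<nu> + 1) x"

lemma bessel_K_ratio_pos: "0 < x \<Longrightarrow> 0 < bessel_K_ratio \<nu> x"
  by (simp add: bessel_K_ratio_def bessel_K_pos)

lemma bessel_K_ratio_deriv:
  assumes "0 < x"
  shows "(bessel_K_ratio \<nu> has_real_derivative
           (bessel_K_ratio \<nu> x)\<^sup>2 - 1 + (2 * \<nu> + 1) / x * bessel_K_ratio \<nu> x) (at x)"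
proof -
  have pos: "bessel_K (\<nu> + 1) x \<noteq> 0" using bessel_K_pos[OF assms, of "\<nu> + 1"] by simp
  have K: "(bessel_K (\<nu> + 1) has_real_derivative - bessel_K \<nu> x - (\<nu> + 1) / x * bessel_K (\<nu> + 1) x) (at x)"
    using bessel_K_deriv[OF assms, of "\<nu> + 1"] by simp
  have "(- j + \<nu> / x * i) * j - i * (- i - (\<nu> + 1) / x * j) = ((i / j)\<^sup>2 - 1 + (2 * \<nu> + 1) / x * (i / j)) * (j * j)"
    if "j \<noteq> 0" for i j :: real
    using assms that by (simp add: field_simps power2_eq_square)
  from this[OF pos, of "bessel_K \<nu> x"] show ?thesis
    using DERIV_divide[OF bessel_K_deriv'[OF assms, of \<nu>] K pos] pos
    unfolding bessel_K_ratio_def[abs_def] by simp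
qed

text \<open>
The ratio \<open>\<kappa>\<close> solves \<open>\<kappa>' = \<kappa>\<^sup>2 - 1 + c\<kappa>/x\<close> with \<open>c = 2\<nu>+1 > 0\<close>. Put \<open>d = -\<kappa>'\<close>. Differentiating the
equation shows \<open>d' \<ge> (2\<kappa> + c/x) d\<close>, so if \<open>d\<close> were positive somewhere it would stay positive and
increase. Then \<open>\<kappa>\<close> would decrease at least linearly and become negative.
\<close>

lemma bessel_K_ratio_mono:
  assumes "\<nu> > -1/2" "0 < x" "x \<le> y"
  shows "bessel_K_ratio \<nu> x \<le> bessel_K_ratio \<nu> y"
proof -
  let ?\<kappa> = "bessel_K_ratio \<nu>"
  define c where "c = 2 * \<nu> + 1"
  have c: "0 < c" using assms by (simp add: c_def)
  define d where "d = (\<lambda>x. 1 - (?\<kappa> x)\<^sup>2 - c / x * ?\<kappa> x)"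
  have \<kappa>: "(?\<kappa> has_real_derivative - d t) (at t)" if "0 < t" for t
    using bessel_K_ratio_deriv[OF that, of \<nu>] by (simp add: d_def c_def algebra_simps)
  have d': "(d has_real_derivative (2 * ?\<kappa> t + c / t) * d t + c * ?\<kappa> t / t\<^sup>2) (at t)" if "0 < t" for t
  proof -
    have "((\<lambda>x. (?\<kappa> x)\<^sup>2) has_real_derivative 2 * ?\<kappa> t * - d t) (at t)"
      by (rule DERIV_cong[OF DERIV_power[OF \<kappa>[OF that], of 2]]) simp
    moreover have "((\<lambda>x. c / x) has_real_derivative - (c / t\<^sup>2)) (at t)"
      using that by (auto intro!: derivative_eq_intros simp: power2_eq_square)
    ultimately have "(d has_real_derivative 0 - 2 * ?\<kappa> t * - d t - (- (c / t\<^sup>2) * ?\<kappa> t + - d t * (c / t))) (at t)"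
      unfolding d_def[abs_def] by (intro DERIV_diff DERIV_const DERIV_mult \<kappa>[OF that, unfolded d_def])
    then show ?thesis by (rule DERIV_cong) (simp add: algebra_simps)
  qed
  have "d t \<le> 0" if t: "0 < t" for t
  proof (rule ccontr)
    assume "\<not> d t \<le> 0"
    then have pos: "0 < d t" by simp
    have pos': "0 < d u" if tu: "t \<le> u" for u
    proof -
      have "continuous_on {t..u} (\<lambda>s. - (2 * ?\<kappa> s + c / s))"
        using t by (intro continuous_intros continuous_at_imp_continuous_on ballI)
          (auto intro!: DERIV_isCont[OF \<kappa>])
      moreover have "0 \<le> (2 * ?\<kappa> s + c / s) * d s + c * ?\<kappa> s / s\<^sup>2 + - (2 * ?\<kappa> s + c / s) * d s" if "s \<in> {t..u}" for s
      proof -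
        have "0 \<le> c * ?\<kappa> s / s\<^sup>2" using that t c bessel_K_ratio_pos[of s \<nu>] by simp
        then show ?thesis by (simp add: algebra_simps)
      qed
      ultimately obtain E where "0 < E" "E * d t \<le> d u"
        using linear_differential_inequality[OF tu, of d "\<lambda>t. (2 * ?\<kappa> t + c / t) * d t + c * ?\<kappa> t / t\<^sup>2" "\<lambda>s. - (2 * ?\<kappa> s + c / s)"] d' t
        by auto
      moreover have "0 < E * d t" using \<open>0 < E\<close> pos by simp
      ultimately show ?thesis by linarith
    qed
    have d_ge: "d t \<le> d u" if "t \<le> u" for u
    proof (rule DERIV_nonneg_imp_nondecreasing[OF that])
      fix s assume s: "t \<le> s" "s \<le> u"
      have "0 \<le> (2 * ?\<kappa> s + c / s) * d s + c * ?\<kappa> s / s\<^sup>2"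
        using s t c pos'[of s] bessel_K_ratio_pos[of s \<nu>] by simp
      then show "\<exists>y. (d has_real_derivative y) (at s) \<and> 0 \<le> y"
        using d'[of s] s t by auto
    qed
    \<comment> \<open>The tangent of \<open>\<kappa>\<close> at \<open>t\<close> vanishes at \<open>u\<close>.\<close>
    define u where "u = t + ?\<kappa> t / d t"
    have u: "t \<le> u" using pos bessel_K_ratio_pos[OF t, of \<nu>] by (simp add: u_def)
    have "?\<kappa> u + d t * u \<le> ?\<kappa> t + d t * t"
    proof (rule DERIV_nonpos_imp_nonincreasing[OF u])
      fix s assume s: "t \<le> s" "s \<le> u"
      show "\<exists>y. ((\<lambda>u. ?\<kappa> u + d t * u) has_real_derivative y) (at s) \<and> y \<le> 0"
        using s t d_ge[of s] by (intro exI[of _ "- d s + d t"]) (auto intro!: derivative_eq_intros \<kappa>)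
    qed
    also have "\<dots> = d t * u" using pos by (simp add: u_def field_simps)
    finally have "?\<kappa> u \<le> 0" by simp
    then show False using bessel_K_ratio_pos[of u \<nu>] u t by simp
  qed
  then have "\<exists>D. (?\<kappa> has_real_derivative D) (at t) \<and> 0 \<le> D" if "x \<le> t" for t
    using \<kappa>[of t] that assms by (intro exI[of _ "- d t"]) auto
  then show ?thesis by (intro DERIV_nonneg_imp_nondecreasing[OF assms(3)])
qed

text \<open>
The function \<open>B/h\<close> is nonincreasing, so it is bounded by its limit at 0. Its derivative is
\<open>((\<kappa> - \<beta>) B - h)/h\<close>, where \<open>\<beta> - \<kappa>\<close> is the logarithmic derivative of \<open>h\<close>. Since \<open>\<kappa>\<close> increases, \<open>h\<close>
decays from \<open>t\<close> on at least like \<open>exp (- (\<kappa>(t) - \<beta>) (s - t))\<close>, which gives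
\<open>(\<kappa>(t) - \<beta>) B(t) \<le> h(t)\<close>.
\<close>

lemma exp_bessel_K_tail_le:
  assumes "\<nu> > -1/2" "\<beta> < 1" "0 < x"
  defines "B \<equiv> \<lambda>x. LBINT t:{x<..}. exp (\<beta> * t) * (t powr (\<nu> + 1) * bessel_K (\<nu> + 1) t)"
  shows "B x \<le> B 0 / (2 powr \<nu> * Gamma (\<nu> + 1)) * (exp (\<beta> * x) * (x powr (\<nu> + 1) * bessel_K (\<nu> + 1) x))"
proof -
  define h where "h = (\<lambda>x. exp (\<beta> * x) * (x powr (\<nu> + 1) * bessel_K (\<nu> + 1) x))"
  let ?\<kappa> = "bessel_K_ratio \<nu>"
  have h_pos: "0 < h t" if "0 < t" for t using that by (simp add: h_def bessel_K_pos)
  have h': "(h has_real_derivative h t * (\<beta> - ?\<kappa> t)) (at t)" if "0 < t" for t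
    unfolding h_def
    by (rule DERIV_cong[OF exp_bessel_K_deriv[OF that]])
      (use bessel_K_pos[OF that, of "\<nu> + 1"] in \<open>simp add: bessel_K_ratio_def field_simps\<close>)
  have int: "set_integrable lborel {0<..} h"
    unfolding h_def using assms by (intro bessel_K_laplace_integrable) auto
  have B_def': "B = (\<lambda>x. LBINT t:{x<..}. h t)" by (simp add: B_def h_def)
  have B': "(B has_real_derivative - h t) (at t)" if "0 < t" for t
    unfolding B_def h_def
    by (rule exp_bessel_K_tail_deriv[OF that]) (use int in \<open>simp add: h_def\<close>)
  have B_top: "(B \<longlongrightarrow> 0) at_top" unfolding B_def' by (rule tail_integral_at_top[OF int])
  have h_top: "(h \<longlongrightarrow> 0) at_top" unfolding h_def using assms by (intro exp_bessel_K_at_top) auto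
  have B_nonneg: "0 \<le> B t" if "0 < t" for t
    unfolding B_def set_lebesgue_integral_def
    by (rule Bochner_Integration.integral_nonneg) (simp add: bessel_K_nonneg)
  have key: "(?\<kappa> t - \<beta>) * B t \<le> h t" if t: "0 < t" for t
  proof -
    have "0 \<le> h t - (?\<kappa> t - \<beta>) * B t"
    proof (rule tendsto_upperbound)
      have "((\<lambda>u. h u - (?\<kappa> t - \<beta>) * B u) \<longlongrightarrow> 0 - (?\<kappa> t - \<beta>) * 0) at_top"
        by (intro tendsto_intros B_top h_top)
      then show "((\<lambda>u. h u - (?\<kappa> t - \<beta>) * B u) \<longlongrightarrow> 0) at_top" by simp
      \<comment> \<open>With \<open>\<kappa>\<close> frozen at \<open>t\<close> this function is nonincreasing and tends to 0.\<close>
      have "h u - (?\<kappa> t - \<beta>) * B u \<le> h t - (?\<kappa> t - \<beta>) * B t" if "t \<le> u" for u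
      proof (rule DERIV_nonpos_imp_nonincreasing[OF that])
        fix s assume s: "t \<le> s" "s \<le> u"
        have "h s * (?\<kappa> t - ?\<kappa> s) \<le> 0"
          using h_pos[of s] bessel_K_ratio_mono[of \<nu> t s] assms s t by (intro mult_nonneg_nonpos) auto
        then show "\<exists>y. ((\<lambda>u. h u - (?\<kappa> t - \<beta>) * B u) has_real_derivative y) (at s) \<and> y \<le> 0"
          using s t by (intro exI[of _ "h s * (?\<kappa> t - ?\<kappa> s)"])
            (auto intro!: derivative_eq_intros h' B' simp: algebra_simps)
      qed
      then show "eventually (\<lambda>u. h u - (?\<kappa> t - \<beta>) * B u \<le> h t - (?\<kappa> t - \<beta>) * B t) at_top"
        by (rule eventually_mono[OF eventually_ge_at_top[of t]])
    qed simp
    then show ?thesis by simp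
  qed
  have mono: "B x / h x \<le> B y / h y" if "0 < y" "y \<le> x" for y
  proof (rule DERIV_nonpos_imp_nonincreasing[OF that(2)])
    fix t assume "y \<le> t" "t \<le> x"
    then have t: "0 < t" using that by simp
    have "((\<lambda>t. B t / h t) has_real_derivative ((?\<kappa> t - \<beta>) * B t - h t) / h t) (at t)"
      by (rule DERIV_cong[OF DERIV_divide[OF B'[OF t] h'[OF t]]])
        (use h_pos[OF t] in \<open>simp_all add: field_simps\<close>)
    moreover have "((?\<kappa> t - \<beta>) * B t - h t) / h t \<le> 0"
      using key[OF t] h_pos[OF t] by (simp add: divide_nonpos_pos)
    ultimately show "\<exists>D. ((\<lambda>t. B t / h t) has_real_derivative D) (at t) \<and> D \<le> 0" by blast
  qed
  have Gpos: "0 < Gamma (\<nu> + 1)" using assms by (intro Gamma_real_pos) auto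
  have "((\<lambda>y. exp (\<beta> * y)) \<longlongrightarrow> 1) (at_right 0)" by (auto intro!: tendsto_eq_intros)
  moreover have "((\<lambda>x. x powr (\<nu> + 1) * bessel_K (\<nu> + 1) x) \<longlongrightarrow> 2 powr \<nu> * Gamma (\<nu> + 1)) (at_right 0)"
    using bessel_K_at_right_0[of "\<nu> + 1"] assms by simp
  ultimately have "(h \<longlongrightarrow> 1 * (2 powr \<nu> * Gamma (\<nu> + 1))) (at_right 0)"
    unfolding h_def by (rule tendsto_mult)
  moreover have "(B \<longlongrightarrow> B 0) (at_right 0)"
    unfolding B_def' by (rule tail_integral_at_right_0[OF int])
  ultimately have "((\<lambda>y. B y / h y) \<longlongrightarrow> B 0 / (1 * (2 powr \<nu> * Gamma (\<nu> + 1)))) (at_right 0)"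
    using Gpos by (intro tendsto_divide) auto
  moreover have "eventually (\<lambda>y. B x / h x \<le> B y / h y) (at_right 0)"
    using eventually_at_right_real[OF assms(3)] by eventually_elim (auto intro: mono)
  ultimately have "B x / h x \<le> B 0 / (2 powr \<nu> * Gamma (\<nu> + 1))"
    by (intro tendsto_lowerbound[of _ _ "at_right 0"]) auto
  then show ?thesis using h_pos[OF assms(3)] by (simp add: h_def pos_divide_le_eq)
qed

section \<open>Products of the two Bessel functions\<close>

lemma bessel_I_ratio_at_right_0:
  assumes "\<nu> > -1"
  shows "(bessel_I_ratio \<nu> \<longlongrightarrow> 0) (at_right 0)"
proof (rule tendsto_sandwich[of "\<lambda>_. 0"])
  show "((\<lambda>x. x / (2 * \<nu> + 2)) \<longlongrightarrow> 0) (at_right 0)"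
    using assms by (auto intro!: tendsto_eq_intros)
  show "eventually (\<lambda>x. 0 \<le> bessel_I_ratio \<nu> x) (at_right 0)"
    using eventually_at_right_less[of 0]
    by eventually_elim (use assms bessel_I_ratio_pos in \<open>auto intro: less_imp_le\<close>)
  show "eventually (\<lambda>x. bessel_I_ratio \<nu> x \<le> x / (2 * \<nu> + 2)) (at_right 0)"
    using eventually_at_right_less[of 0]
    by eventually_elim (use assms bessel_I_ratio_le in auto)
qed simp

lemma bessel_I_Suc: "0 < x \<Longrightarrow> \<nu> > -1 \<Longrightarrow> bessel_I (\<nu> + 1) x = bessel_I_ratio \<nu> x * bessel_I \<nu> x"
  using bessel_I_pos[of x \<nu>] by (simp add: bessel_I_ratio_def)

lemma bessel_cross_product_at_right_0:
  assumes "\<nu> > -1"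
  shows "((\<lambda>x. x * bessel_I \<nu> x * bessel_K (\<nu> + 1) x) \<longlongrightarrow> 1) (at_right 0)"
proof -
  have "((\<lambda>x. bessel_I \<nu> x / x powr \<nu> * (x powr (\<nu> + 1) * bessel_K (\<nu> + 1) x))
      \<longlongrightarrow> 1 / (2 powr \<nu> * Gamma (\<nu> + 1)) * (2 powr \<nu> * Gamma (\<nu> + 1))) (at_right 0)"
    using bessel_K_at_right_0[of "\<nu> + 1"] assms by (intro tendsto_mult[OF bessel_I_at_right_0[OF assms]]) simp
  moreover have "eventually (\<lambda>x. bessel_I \<nu> x / x powr \<nu> * (x powr (\<nu> + 1) * bessel_K (\<nu> + 1) x)
      = x * bessel_I \<nu> x * bessel_K (\<nu> + 1) x) (at_right 0)"
    using eventually_at_right_less[of 0] by eventually_elim (simp add: powr_add)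
  moreover have "0 < Gamma (\<nu> + 1)" using assms by (intro Gamma_real_pos) simp
  ultimately show ?thesis by (simp add: tendsto_cong)
qed

text \<open>
The left-hand side has derivative 0. Its value is found at 0, where the first summand tends to 1 and
the second, at most \<open>r\<close> times the first, tends to 0.
\<close>

lemma bessel_Wronskian:
  assumes "0 < x" "\<nu> > -1/2"
  shows "x * bessel_I \<nu> x * bessel_K (\<nu> + 1) x + x * bessel_I (\<nu> + 1) x * bessel_K \<nu> x = 1"
proof -
  let ?I = "bessel_I \<nu>" and ?J = "bessel_I (\<nu> + 1)" and ?K = "bessel_K \<nu>" and ?L = "bessel_K (\<nu> + 1)"
  let ?W = "\<lambda>x. x * ?I x * ?L x + x * ?J x * ?K x"
  have der: "(?W has_real_derivative 0) (at t)" if t: "0 < t" for t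
  proof -
    have L: "(?L has_real_derivative - ?K t - (\<nu> + 1) / t * ?L t) (at t)"
      using bessel_K_deriv[OF t, of "\<nu> + 1"] by simp
    have n: "\<nu> > -1" using assms by simp
    show ?thesis
      by (rule DERIV_cong[OF DERIV_add[OF DERIV_mult[OF DERIV_mult[OF DERIV_ident bessel_I_deriv[OF t n]] L]
            DERIV_mult[OF DERIV_mult[OF DERIV_ident bessel_I_deriv'[OF t n]] bessel_K_deriv'[OF t, of \<nu>]]]])
        (use t in \<open>simp add: field_simps\<close>)
  qed
  have const: "?W y = ?W x" if "0 < y" "y < x" for y
  proof (rule sym, rule DERIV_isconst2[of y x])
    show "continuous_on {y..x} ?W"
      by (intro continuous_at_imp_continuous_on ballI DERIV_isCont[OF der]) (use that in auto)
  qed (use that der in auto)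
  have cross: "((\<lambda>x. x * ?I x * ?L x) \<longlongrightarrow> 1) (at_right 0)"
    using assms by (intro bessel_cross_product_at_right_0) auto
  have "((\<lambda>x. x * ?J x * ?K x) \<longlongrightarrow> 0) (at_right 0)"
  proof (rule tendsto_sandwich[of "\<lambda>_. 0"])
    show "((\<lambda>x. bessel_I_ratio \<nu> x * (x * ?I x * ?L x)) \<longlongrightarrow> 0) (at_right 0)"
      using tendsto_mult[OF bessel_I_ratio_at_right_0 cross] assms by simp
    show "eventually (\<lambda>x. 0 \<le> x * ?J x * ?K x) (at_right 0)"
      using eventually_at_right_less[of 0]
      by eventually_elim (use assms bessel_I_pos bessel_K_pos in \<open>auto intro: less_imp_le\<close>)
    show "eventually (\<lambda>x. x * ?J x * ?K x \<le> bessel_I_ratio \<nu> x * (x * ?I x * ?L x)) (at_right 0)"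
      using eventually_at_right_less[of 0]
    proof eventually_elim
      fix x :: real assume x: "0 < x"
      have "x * ?J x * ?K x \<le> x * ?J x * ?L x"
        using x assms bessel_I_pos[of x "\<nu> + 1"] by (intro mult_left_mono bessel_K_mono) auto
      then show "x * ?J x * ?K x \<le> bessel_I_ratio \<nu> x * (x * ?I x * ?L x)"
        using x assms by (simp add: bessel_I_Suc mult_ac)
    qed
  qed simp
  from tendsto_add[OF cross this] have "(?W \<longlongrightarrow> 1) (at_right 0)" by simp
  moreover have "eventually (\<lambda>y. ?W y = ?W x) (at_right 0)"
    using eventually_at_right_real[OF assms(1)] by eventually_elim (auto intro!: const)
  ultimately have "((\<lambda>_. ?W x) \<longlongrightarrow> 1) (at_right (0::real))" by (simp add: tendsto_cong)
  then show ?thesis by (simp add: tendsto_const_iff)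
qed

lemma bessel_cross_product_lt_1:
  assumes "0 < x" "\<nu> > -1/2"
  shows "x * bessel_I \<nu> x * bessel_K (\<nu> + 1) x < 1"
proof -
  have "0 < x * bessel_I (\<nu> + 1) x * bessel_K \<nu> x"
    using assms bessel_I_pos[of x "\<nu> + 1"] bessel_K_pos[of x \<nu>] by simp
  then show ?thesis using bessel_Wronskian[OF assms] by linarith
qed

definition bessel_product :: "real \<Rightarrow> real \<Rightarrow> real" where
  "bessel_product \<nu> x = x * bessel_I \<nu> x * bessel_K \<nu> x"

lemma bessel_product_le_1:
  assumes "0 < x" "\<nu> > -1/2"
  shows "bessel_product \<nu> x \<le> 1"
proof -
  have "bessel_product \<nu> x \<le> x * bessel_I \<nu> x * bessel_K (\<nu> + 1) x"
    unfolding bessel_product_def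
    using assms bessel_I_pos[of x \<nu>] by (intro mult_left_mono bessel_K_mono) auto
  then show ?thesis using bessel_cross_product_lt_1[OF assms] by simp
qed

text \<open>
The Wronskian identity eliminates \<open>K\<^bsub>\<nu>+1\<^esub>\<close> and makes the equation linear in the product.
\<close>

lemma bessel_product_deriv:
  assumes "0 < x" "\<nu> > -1/2"
  shows "(bessel_product \<nu> has_real_derivative
    2 * (bessel_I_ratio \<nu> x + (\<nu> + 1/2) / x) * bessel_product \<nu> x - 1) (at x)"
proof -
  have n: "\<nu> > -1" using assms by simp
  have L: "x * bessel_I \<nu> x * bessel_K (\<nu> + 1) x = 1 - x * (bessel_I_ratio \<nu> x * bessel_I \<nu> x) * bessel_K \<nu> x"
    using bessel_Wronskian[OF assms] bessel_I_Suc[OF assms(1) n] by simp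
  have "(bessel_product \<nu> has_real_derivative
      (1 * bessel_I \<nu> x + (bessel_I (\<nu> + 1) x + \<nu> / x * bessel_I \<nu> x) * x) * bessel_K \<nu> x
      + (- bessel_K (\<nu> + 1) x + \<nu> / x * bessel_K \<nu> x) * (x * bessel_I \<nu> x)) (at x)"
    unfolding bessel_product_def[abs_def]
    by (intro DERIV_mult DERIV_ident bessel_I_deriv bessel_K_deriv' assms n)
  moreover have "(- bessel_K (\<nu> + 1) x + \<nu> / x * bessel_K \<nu> x) * (x * bessel_I \<nu> x)
      = - (x * bessel_I \<nu> x * bessel_K (\<nu> + 1) x) + \<nu> * bessel_I \<nu> x * bessel_K \<nu> x"
    using assms by (simp add: field_simps)
  ultimately have "(bessel_product \<nu> has_real_derivative
      (1 * bessel_I \<nu> x + (bessel_I (\<nu> + 1) x + \<nu> / x * bessel_I \<nu> x) * x) * bessel_K \<nu> x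
      + (- (1 - x * (bessel_I_ratio \<nu> x * bessel_I \<nu> x) * bessel_K \<nu> x) + \<nu> * bessel_I \<nu> x * bessel_K \<nu> x)) (at x)"
    unfolding L by simp
  then show ?thesis
    unfolding bessel_I_Suc[OF assms(1) n]
    by (rule DERIV_cong) (use assms in \<open>simp add: bessel_product_def field_simps\<close>)
qed

lemma continuous_on_bessel_I_ratio: "\<nu> > -1 \<Longrightarrow> continuous_on {0<..} (bessel_I_ratio \<nu>)"
  by (intro continuous_at_imp_continuous_on ballI DERIV_isCont[OF bessel_I_ratio_deriv]) auto

text \<open>
The difference \<open>f = w - 1/2\<close> satisfies \<open>f' = 2\<rho>f + (\<rho> - 1)\<close> with \<open>\<rho> = r + a/x > 1\<close>, and it is bounded.
\<close>

lemma bessel_product_lt_half: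
  assumes "0 < x" "\<nu> \<ge> 1/2"
  shows "bessel_product \<nu> x < 1/2"
proof -
  let ?g = "\<lambda>x. 2 * (bessel_I_ratio \<nu> x + (\<nu> + 1/2) / x)"
  have g: "2 < ?g t" if "0 < t" for t
  proof -
    have "1 < bessel_I_ratio \<nu> t + (\<nu> + 1/2) / t"
      using bessel_I_ratio_gt_large_order[OF that assms(2)] by (simp only: diff_less_eq)
    then have "2 * 1 < ?g t" by (rule mult_strict_left_mono) simp
    then show ?thesis by (simp only: mult_1_right)
  qed
  have "bessel_product \<nu> x - 1/2 < 0"
  proof (rule bounded_subsolution_negative[where f = "\<lambda>x. bessel_product \<nu> x - 1/2" and x = x
        and g = ?g and c = 2 and X = 1 and B = 1])
    fix t :: real assume t: "0 < t"
    show "((\<lambda>x. bessel_product \<nu> x - 1/2) has_real_derivative ?g t * bessel_product \<nu> t - 1) (at t)"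
      using DERIV_diff[OF bessel_product_deriv[OF t] DERIV_const[of "1/2"]] assms by simp
    have "?g t * (p - 1/2) < ?g t * p - 1" for p
      using g[OF t] by (simp add: right_diff_distrib)
    then show "?g t * (bessel_product \<nu> t - 1/2) < ?g t * bessel_product \<nu> t - 1" .
    show "bessel_product \<nu> t - 1/2 \<le> 1" using bessel_product_le_1[OF t, of \<nu>] assms by simp
  next
    show "continuous_on {0<..} ?g"
      using assms by (intro continuous_intros continuous_on_bessel_I_ratio) auto
    show "2 \<le> ?g t" if "1 \<le> t" for t using g[of t] that by simp
  qed (use assms in auto)
  then show ?thesis by simp
qed

text \<open>
The difference \<open>f = 2w - 1/x - r\<close> satisfies
\<open>f' - 2 (r + a/x) f = 3r\<^sup>2 + 2mr/x + m/x\<^sup>2 - 3\<close> with \<open>m = 2\<nu>+2\<close>. As \<open>m \<le> 3\<close>, the right-hand side is at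
least \<open>3 (r + m/(3x))\<^sup>2 - 3\<close>, which is positive by the lower bound on \<open>r\<close>. Since \<open>f\<close> is bounded above,
it must be negative.
\<close>

lemma bessel_product_lt_small_order:
  assumes "0 < x" "-1/2 < \<nu>" "\<nu> \<le> 1/2"
  shows "2 * bessel_product \<nu> x < 1 / x + bessel_I_ratio \<nu> x"
proof -
  let ?r = "bessel_I_ratio \<nu>"
  let ?g = "\<lambda>x. 2 * (?r x + (\<nu> + 1/2) / x)"
  define m where "m = 2 * \<nu> + 2"
  have m: "1 < m" "m \<le> 3" using assms by (auto simp: m_def)
  have r: "1 - m / (3 * t) < ?r t" if "0 < t" for t
    using bessel_I_ratio_gt_small_order[OF that assms(2,3)] by (simp add: m_def)
  have "2 * bessel_product \<nu> x - 1 / x - ?r x < 0"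
  proof (rule bounded_subsolution_negative[where f = "\<lambda>x. 2 * bessel_product \<nu> x - 1 / x - ?r x" and x = x
        and g = ?g and c = 1 and X = 2 and B = 2])
    fix t :: real assume t: "0 < t"
    have n: "\<nu> > -1" using assms by simp
    have inv: "((\<lambda>x. 1 / x) has_real_derivative - (1 / t\<^sup>2)) (at t)"
      using t by (auto intro!: derivative_eq_intros simp: power2_eq_square)
    show "((\<lambda>x. 2 * bessel_product \<nu> x - 1 / x - ?r x) has_real_derivative
        2 * (?g t * bessel_product \<nu> t - 1) - - (1 / t\<^sup>2) - (1 - (?r t)\<^sup>2 - (2 * \<nu> + 1) / t * ?r t)) (at t)"
      by (intro DERIV_diff DERIV_cmult inv bessel_I_ratio_deriv bessel_product_deriv t n assms)
    have "0 < 3 * (?r t)\<^sup>2 + 2 * m * ?r t / t + m / t\<^sup>2 - 3"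
    proof -
      have "1 < ?r t + m / (3 * t)" using r[OF t] by simp
      then have "1 < (?r t + m / (3 * t))\<^sup>2" by (simp add: one_less_power)
      also have "3 * (?r t + m / (3 * t))\<^sup>2 = 3 * (?r t)\<^sup>2 + 2 * m * ?r t / t + (m * m / 3) / t\<^sup>2"
        using t by (simp add: field_simps power2_eq_square)
      then have "(?r t + m / (3 * t))\<^sup>2 = (3 * (?r t)\<^sup>2 + 2 * m * ?r t / t + (m * m / 3) / t\<^sup>2) / 3" by simp
      finally have "3 < 3 * (?r t)\<^sup>2 + 2 * m * ?r t / t + (m * m / 3) / t\<^sup>2" by simp
      moreover have "(m * m / 3) / t\<^sup>2 \<le> m / t\<^sup>2"
        using m by (intro divide_right_mono) auto
      ultimately show ?thesis by linarith
    qed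
    moreover have "(2 * (?g t * p - 1) - - (1 / t\<^sup>2) - (1 - (?r t)\<^sup>2 - (2 * \<nu> + 1) / t * ?r t))
        - ?g t * (2 * p - 1 / t - ?r t) = 3 * (?r t)\<^sup>2 + 2 * m * ?r t / t + m / t\<^sup>2 - 3" for p
      using t by (simp add: m_def field_simps power2_eq_square)
    ultimately show "?g t * (2 * bessel_product \<nu> t - 1 / t - ?r t)
        < 2 * (?g t * bessel_product \<nu> t - 1) - - (1 / t\<^sup>2) - (1 - (?r t)\<^sup>2 - (2 * \<nu> + 1) / t * ?r t)"
      by (smt (verit))
    have "0 < 1 / t" using t by simp
    then show "2 * bessel_product \<nu> t - 1 / t - ?r t \<le> 2"
      using bessel_product_le_1[OF t, of \<nu>] bessel_I_ratio_pos[OF t n] assms by linarith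
  next
    show "continuous_on {0<..} ?g"
      using assms by (intro continuous_intros continuous_on_bessel_I_ratio) auto
    fix t :: real assume t: "2 \<le> t"
    have "m / (3 * t) \<le> 1 / 2" using t m by (simp add: field_simps)
    moreover have "0 \<le> (\<nu> + 1/2) / t" using t assms by simp
    moreover have "1 - m / (3 * t) < ?r t" using r t by simp
    ultimately have "1/2 \<le> ?r t" "0 \<le> (\<nu> + 1/2) / t" by linarith+
    then have "2 * (1/2) \<le> ?g t" by (intro mult_left_mono add_increasing2) auto
    then show "1 \<le> ?g t" by (simp only: mult_2 field_sum_of_halves)
  qed (use assms in auto)
  then show ?thesis by simp
qed

section \<open>Weighted integrals of K against I\<close>

definition bessel_K_integral :: "real \<Rightarrow> real \<Rightarrow> real \<Rightarrow> real \<Rightarrow> real" where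
  "bessel_K_integral \<beta> p \<nu> x = (LBINT t:{x<..}. exp (\<beta> * t) * t powr p * bessel_K \<nu> t)"

lemma bessel_K_integral_pos:
  assumes "0 \<le> x" "set_integrable lborel {0<..} (\<lambda>t. exp (\<beta> * t) * t powr p * bessel_K \<nu> t)"
  shows "0 < bessel_K_integral \<beta> p \<nu> x"
  unfolding bessel_K_integral_def
  by (rule set_integral_pos[OF set_integrable_subset[OF assms(2)]]) (use assms bessel_K_pos in auto)

lemma bessel_K_weighted_integrable:
  assumes "\<nu> > -1/2" "\<beta> < 1"
  shows "set_integrable lborel {0<..} (\<lambda>t. exp (\<beta> * t) * t powr \<nu> * bessel_K \<nu> t)"
    "set_integrable lborel {0<..} (\<lambda>t. exp (\<beta> * t) * t powr (\<nu> + 1) * bessel_K \<nu> t)"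
    "set_integrable lborel {0<..} (\<lambda>t. exp (\<beta> * t) * t powr (\<nu> + 1) * bessel_K (\<nu> + 1) t)"
  using bessel_K_laplace_integrable[OF assms] bessel_K_laplace_integrable_raised[OF assms]
    bessel_K_laplace_integrable[of "\<nu> + 1" \<beta>] assms
  by (simp_all add: mult.assoc)

lemma bessel_K_integral_tendsto:
  assumes "set_integrable lborel {0<..} (\<lambda>t. exp (\<beta> * t) * t powr p * bessel_K \<nu> t)"
  shows "(bessel_K_integral \<beta> p \<nu> \<longlongrightarrow> bessel_K_integral \<beta> p \<nu> 0) (at_right 0)"
    "(bessel_K_integral \<beta> p \<nu> \<longlongrightarrow> 0) at_top"
  unfolding bessel_K_integral_def[abs_def]
  using tail_integral_at_right_0[OF assms] tail_integral_at_top[OF assms] by auto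

text \<open>
The limit at 0 of the quotient in \<open>exp_bessel_K_tail_le\<close>.
\<close>

definition tail_const :: "real \<Rightarrow> real \<Rightarrow> real" where
  "tail_const \<nu> \<beta> = bessel_K_integral \<beta> (\<nu> + 1) (\<nu> + 1) 0 / (2 powr \<nu> * Gamma (\<nu> + 1))"

lemma tail_const_pos:
  assumes "\<nu> > -1/2" "\<beta> < 1"
  shows "0 < tail_const \<nu> \<beta>"
  unfolding tail_const_def
  using assms Gamma_real_pos[of "\<nu> + 1"] by (simp add: bessel_K_integral_pos bessel_K_weighted_integrable)

lemma tail_const_less:
  assumes "\<nu> > -1/2" "0 < \<beta>" "\<beta> < 1"
  shows "tail_const \<nu> \<beta>
    < 2 * sqrt pi * Gamma (\<nu> + 3/2) / ((1 - \<beta>\<^sup>2) powr (\<nu> + 3/2) * Gamma (\<nu> + 1))"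
proof -
  have G: "0 < Gamma (\<nu> + 1)" using assms by (intro Gamma_real_pos) auto
  have "bessel_K_integral \<beta> (\<nu> + 1) (\<nu> + 1) 0
      < sqrt pi * 2 powr (\<nu> + 1) * Gamma (\<nu> + 3/2) / (1 - \<beta>\<^sup>2) powr (\<nu> + 3/2)"
    using bessel_K_laplace_less(2)[of "\<nu> + 1" \<beta>] assms
    by (simp add: bessel_K_integral_def mult.assoc add.assoc)
  then have "tail_const \<nu> \<beta> < sqrt pi * 2 powr (\<nu> + 1) * Gamma (\<nu> + 3/2) / (1 - \<beta>\<^sup>2) powr (\<nu> + 3/2) / (2 powr \<nu> * Gamma (\<nu> + 1))"
    unfolding tail_const_def using G by (intro divide_strict_right_mono) auto
  also have "\<dots> = 2 * sqrt pi * Gamma (\<nu> + 3/2) / ((1 - \<beta>\<^sup>2) powr (\<nu> + 3/2) * Gamma (\<nu> + 1))"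
    by (simp only: powr_add[of 2 \<nu> 1]) (simp add: mult_ac)
  finally show ?thesis .
qed

definition scaled_I :: "real \<Rightarrow> real \<Rightarrow> real \<Rightarrow> real" where
  "scaled_I \<beta> \<nu> x = exp (- \<beta> * x) * bessel_I \<nu> x / x powr \<nu>"

lemma scaled_I_pos: "0 < x \<Longrightarrow> \<nu> > -1 \<Longrightarrow> 0 < scaled_I \<beta> \<nu> x"
  by (simp add: scaled_I_def bessel_I_pos)

lemma scaled_I_at_right_0:
  assumes "\<nu> > -1"
  shows "(scaled_I \<beta> \<nu> \<longlongrightarrow> 1 / (2 powr \<nu> * Gamma (\<nu> + 1))) (at_right 0)"
proof -
  have "((\<lambda>x. exp (- \<beta> * x)) \<longlongrightarrow> 1) (at_right 0)" by (auto intro!: tendsto_eq_intros)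
  from tendsto_mult[OF this bessel_I_at_right_0[OF assms]] show ?thesis
    by (simp add: scaled_I_def[abs_def])
qed

text \<open>
The scaling of \<open>I\<close> cancels the weight of \<open>K\<close>, which is how the unscaled products of Bessel functions
arise.
\<close>

lemma scaled_I_cancel:
  assumes "0 < x"
  shows "scaled_I \<beta> \<nu> x * (exp (\<beta> * x) * (x powr (\<nu> + 1) * bessel_K \<mu> x)) = x * bessel_I \<nu> x * bessel_K \<mu> x"
  using assms by (simp add: scaled_I_def powr_add exp_minus field_simps)

lemma scaled_I_tail_le:
  assumes "0 < x" "\<nu> > -1/2" "\<beta> < 1"
  shows "scaled_I \<beta> \<nu> x * bessel_K_integral \<beta> (\<nu> + 1) (\<nu> + 1) x
     \<le> tail_const \<nu> \<beta> * (x * bessel_I \<nu> x * bessel_K (\<nu> + 1) x)"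
proof -
  have "scaled_I \<beta> \<nu> x * bessel_K_integral \<beta> (\<nu> + 1) (\<nu> + 1) x
      \<le> scaled_I \<beta> \<nu> x * (tail_const \<nu> \<beta> * (exp (\<beta> * x) * (x powr (\<nu> + 1) * bessel_K (\<nu> + 1) x)))"
    using exp_bessel_K_tail_le[OF assms(2,3,1)] scaled_I_pos[of x \<nu> \<beta>] assms
    by (intro mult_left_mono) (auto simp: bessel_K_integral_def tail_const_def mult.assoc)
  then show ?thesis
    using scaled_I_cancel[OF assms(1), of \<beta> \<nu> "\<nu> + 1"] by (simp add: mult.left_commute)
qed

lemma scaled_integral_by_parts:
  assumes "0 < x" "\<nu> > -1/2" "\<beta> < 1"
  shows "scaled_I \<beta> \<nu> x * bessel_K_integral \<beta> (\<nu> + 1) \<nu> x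
     = x * bessel_I \<nu> x * bessel_K (\<nu> + 1) x
       + \<beta> * (scaled_I \<beta> \<nu> x * bessel_K_integral \<beta> (\<nu> + 1) (\<nu> + 1) x)"
  using bessel_K_integration_by_parts[OF assms] scaled_I_cancel[OF assms(1), of \<beta> \<nu> "\<nu> + 1"]
  by (simp add: bessel_K_integral_def mult.assoc distrib_left mult.left_commute)

lemma scaled_integral_at_right_0:
  assumes "\<nu> > -1/2" "\<beta> < 1"
  shows "((\<lambda>x. scaled_I \<beta> \<nu> x * bessel_K_integral \<beta> (\<nu> + 1) \<nu> x) \<longlongrightarrow> 1 + \<beta> * tail_const \<nu> \<beta>) (at_right 0)"
proof -
  have "((\<lambda>x. x * bessel_I \<nu> x * bessel_K (\<nu> + 1) x
       + \<beta> * (scaled_I \<beta> \<nu> x * bessel_K_integral \<beta> (\<nu> + 1) (\<nu> + 1) x))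
     \<longlongrightarrow> 1 + \<beta> * (1 / (2 powr \<nu> * Gamma (\<nu> + 1)) * bessel_K_integral \<beta> (\<nu> + 1) (\<nu> + 1) 0)) (at_right 0)"
    using assms by (intro tendsto_intros bessel_cross_product_at_right_0 scaled_I_at_right_0
        bessel_K_integral_tendsto bessel_K_weighted_integrable) auto
  moreover have "eventually (\<lambda>x. x * bessel_I \<nu> x * bessel_K (\<nu> + 1) x
       + \<beta> * (scaled_I \<beta> \<nu> x * bessel_K_integral \<beta> (\<nu> + 1) (\<nu> + 1) x)
     = scaled_I \<beta> \<nu> x * bessel_K_integral \<beta> (\<nu> + 1) \<nu> x) (at_right 0)"
    using eventually_at_right_less[of 0]
    by eventually_elim (use assms in \<open>simp add: scaled_integral_by_parts\<close>)
  ultimately show ?thesis by (simp add: tendsto_cong tail_const_def)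
qed

lemma scaled_integral_le_nonpos:
  assumes "0 < x" "\<nu> > -1/2" "\<beta> \<le> 0"
  shows "scaled_I \<beta> \<nu> x * bessel_K_integral \<beta> (\<nu> + 1) \<nu> x \<le> x * bessel_I \<nu> x * bessel_K (\<nu> + 1) x"
proof -
  have "0 < scaled_I \<beta> \<nu> x * bessel_K_integral \<beta> (\<nu> + 1) (\<nu> + 1) x"
    using assms by (intro mult_pos_pos scaled_I_pos bessel_K_integral_pos bessel_K_weighted_integrable) auto
  then have "\<beta> * (scaled_I \<beta> \<nu> x * bessel_K_integral \<beta> (\<nu> + 1) (\<nu> + 1) x) \<le> 0"
    using assms by (intro mult_nonpos_nonneg) auto
  then show ?thesis using scaled_integral_by_parts[of x \<nu> \<beta>] assms by simp
qed

lemma scaled_integral_le_pos: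
  assumes "0 < x" "\<nu> > -1/2" "0 < \<beta>" "\<beta> < 1"
  shows "scaled_I \<beta> \<nu> x * bessel_K_integral \<beta> (\<nu> + 1) \<nu> x
    \<le> (1 + \<beta> * tail_const \<nu> \<beta>) * (x * bessel_I \<nu> x * bessel_K (\<nu> + 1) x)"
proof -
  have "\<beta> * (scaled_I \<beta> \<nu> x * bessel_K_integral \<beta> (\<nu> + 1) (\<nu> + 1) x)
      \<le> \<beta> * (tail_const \<nu> \<beta> * (x * bessel_I \<nu> x * bessel_K (\<nu> + 1) x))"
    using scaled_I_tail_le[of x \<nu> \<beta>] assms by (intro mult_left_mono) auto
  then show ?thesis using scaled_integral_by_parts[of x \<nu> \<beta>] assms by (simp add: distrib_right mult.assoc)
qed

lemma bessel_K_integral_weight_mono: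
  assumes "0 < x" "\<nu> > -1/2" "\<beta> < 1"
  shows "x * bessel_K_integral \<beta> \<nu> \<nu> x \<le> bessel_K_integral \<beta> (\<nu> + 1) \<nu> x"
proof -
  have sub: "set_integrable lborel {x<..} f" if "set_integrable lborel {0<..} f" for f :: "real \<Rightarrow> real"
    by (rule set_integrable_subset[OF that]) (use assms in auto)
  have "(LBINT t:{x<..}. x * (exp (\<beta> * t) * t powr \<nu> * bessel_K \<nu> t))
      \<le> (LBINT t:{x<..}. exp (\<beta> * t) * t powr (\<nu> + 1) * bessel_K \<nu> t)"
  proof (rule set_integral_mono)
    show "set_integrable lborel {x<..} (\<lambda>t. x * (exp (\<beta> * t) * t powr \<nu> * bessel_K \<nu> t))"
      using sub[OF bessel_K_weighted_integrable(1)[OF assms(2,3)]] by simp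
    show "set_integrable lborel {x<..} (\<lambda>t. exp (\<beta> * t) * t powr (\<nu> + 1) * bessel_K \<nu> t)"
      using sub[OF bessel_K_weighted_integrable(2)[OF assms(2,3)]] .
    fix t assume t: "t \<in> {x<..}"
    have "x * (exp (\<beta> * t) * t powr \<nu> * bessel_K \<nu> t) \<le> t * (exp (\<beta> * t) * t powr \<nu> * bessel_K \<nu> t)"
      using t by (intro mult_right_mono) (auto simp: bessel_K_nonneg)
    then show "x * (exp (\<beta> * t) * t powr \<nu> * bessel_K \<nu> t) \<le> exp (\<beta> * t) * t powr (\<nu> + 1) * bessel_K \<nu> t"
      using t assms by (simp add: powr_add mult_ac)
  qed
  then show ?thesis by (simp add: bessel_K_integral_def)
qed

text \<open>
Here \<open>u = 1/(x scaled_I)\<close> and \<open>G = u/(2 (1-\<beta>)) - B\<close>, so the claim is \<open>G > 0\<close>. The function \<open>G\<close> decreases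
and satisfies \<open>G \<ge> -B\<close>, where \<open>B\<close> tends to 0 at infinity.
\<close>

lemma scaled_integral_lt_small_order:
  assumes "0 < x" "-1/2 < \<nu>" "\<nu> \<le> 1/2" "0 \<le> \<beta>" "\<beta> < 1"
  shows "x * (scaled_I \<beta> \<nu> x * bessel_K_integral \<beta> \<nu> \<nu> x) < 1 / (2 * (1 - \<beta>))"
proof -
  have n: "\<nu> > -1" using assms by simp
  let ?r = "bessel_I_ratio \<nu>"
  define B where "B = bessel_K_integral \<beta> \<nu> \<nu>"
  define u where "u = (\<lambda>t. 1 / (t * scaled_I \<beta> \<nu> t))"
  define G where "G = (\<lambda>t. u t / (2 * (1 - \<beta>)) - B t)"
  have u_pos: "0 < u t" if "0 < t" for t
    unfolding u_def using that scaled_I_pos[OF that n, of \<beta>] by simp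
  have u_eq: "u t = exp (\<beta> * t) * t powr (\<nu> - 1) / bessel_I \<nu> t" if "0 < t" for t
    using that bessel_I_pos[OF that n] by (simp add: u_def scaled_I_def powr_diff exp_minus field_simps)
  have int: "set_integrable lborel {0<..} (\<lambda>t. exp (\<beta> * t) * t powr \<nu> * bessel_K \<nu> t)"
    using assms by (intro bessel_K_weighted_integrable) auto
  have u': "(u has_real_derivative u t * (\<beta> - 1 / t - ?r t)) (at t)" if t: "0 < t" for t
  proof -
    have I: "bessel_I \<nu> t \<noteq> 0" using bessel_I_pos[OF t n] by simp
    have e: "((\<lambda>t. exp (\<beta> * t)) has_real_derivative \<beta> * exp (\<beta> * t)) (at t)"
      by (auto intro!: derivative_eq_intros)
    have p: "((\<lambda>t. t powr (\<nu> - 1)) has_real_derivative (\<nu> - 1) / t * t powr (\<nu> - 1)) (at t)"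
      by (rule DERIV_cong[OF has_real_derivative_powr[OF t]]) (use t in \<open>simp add: powr_diff power2_eq_square\<close>)
    have "((\<lambda>t. exp (\<beta> * t) * t powr (\<nu> - 1) / bessel_I \<nu> t) has_real_derivative u t * (\<beta> - 1 / t - ?r t)) (at t)"
      by (rule DERIV_cong[OF DERIV_divide[OF DERIV_mult[OF e p] bessel_I_deriv[OF t n] I]])
        (use I t in \<open>simp add: u_eq bessel_I_Suc[OF t n, simplified add.commute[of \<nu>]] bessel_I_Suc[OF t n] field_simps\<close>)
    then show ?thesis
      by (rule has_field_derivative_transform_within_open[where S = "{0<..}"]) (use t u_eq in auto)
  qed
  have B': "(B has_real_derivative - (u t * bessel_product \<nu> t)) (at t)" if t: "0 < t" for t
  proof -
    have "(B has_real_derivative - (exp (\<beta> * t) * (t powr \<nu> * bessel_K \<nu> t))) (at t)"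
      unfolding B_def bessel_K_integral_def[abs_def] mult.assoc
      by (rule exp_bessel_K_tail_deriv[OF t]) (use int in \<open>simp add: mult.assoc\<close>)
    then show ?thesis
      by (rule DERIV_cong)
        (use t bessel_I_pos[OF t n] in \<open>simp add: u_eq bessel_product_def powr_diff\<close>)
  qed
  have decr: "G t < G s" if "0 < s" "s < t" for s t
  proof (rule DERIV_neg_imp_decreasing[OF that(2)])
    fix y assume "s \<le> y" "y \<le> t"
    then have y: "0 < y" using that by simp
    have r1: "1 < 1 / y + ?r y"
    proof -
      have "(2 * \<nu> + 2) / (3 * y) \<le> 1 / y" using y assms by (simp add: field_simps)
      then show ?thesis using bessel_I_ratio_gt_small_order[OF y assms(2,3)] by linarith
    qed
    \<comment> \<open>The condition for \<open>G' < 0\<close> is affine in \<open>\<beta>\<close>: the convex combination of its two end points.\<close>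
    have "(1 - \<beta>) * (2 * bessel_product \<nu> y) + \<beta> * 1 < (1 - \<beta>) * (1 / y + ?r y) + \<beta> * (1 / y + ?r y)"
      using assms r1 bessel_product_lt_small_order[OF y assms(2,3)]
      by (intro add_less_le_mono mult_strict_left_mono mult_left_mono) auto
    moreover have "(1 - \<beta>) * s + \<beta> * s = s" for s by (simp add: algebra_simps)
    ultimately have key: "(1 - \<beta>) * (2 * bessel_product \<nu> y) < 1 / y + ?r y - \<beta>"
      by (simp only: less_diff_eq mult_1_right)
    have "u y * (\<beta> - 1 / y - ?r y) / (2 * (1 - \<beta>)) - - (u y * bessel_product \<nu> y)
        = u y * ((1 - \<beta>) * (2 * bessel_product \<nu> y) - (1 / y + ?r y - \<beta>)) / (2 * (1 - \<beta>))"
      using assms by (simp add: field_simps)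
    also have "\<dots> < 0"
      using key u_pos[OF y] assms by (intro divide_neg_pos mult_pos_neg) auto
    finally show "\<exists>D. (G has_real_derivative D) (at y) \<and> D < 0"
      unfolding G_def using DERIV_diff[OF DERIV_cdivide[OF u'[OF y]] B'[OF y]] by blast
  qed
  have "((\<lambda>t. - B t) \<longlongrightarrow> - 0) at_top"
    unfolding B_def by (intro tendsto_minus bessel_K_integral_tendsto int)
  moreover have "eventually (\<lambda>t. - B t \<le> G (x + 1)) at_top"
    using eventually_gt_at_top[of "x + 1"]
  proof eventually_elim
    fix t assume t: "x + 1 < t"
    have "- B t \<le> G t" using u_pos[of t] t assms by (simp add: G_def)
    also have "\<dots> \<le> G (x + 1)" using decr[of "x + 1" t] t assms by simp
    finally show "- B t \<le> G (x + 1)" .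
  qed
  ultimately have "0 \<le> G (x + 1)" by (intro tendsto_upperbound[of "\<lambda>t. - B t" _ at_top]) auto
  \<comment> \<open>Comparing at \<open>x + 1\<close> first makes the inequality at \<open>x\<close> strict.\<close>
  also have "\<dots> < G x" using decr[of x "x + 1"] assms by simp
  finally have "B x < u x / (2 * (1 - \<beta>))" by (simp add: G_def)
  then have "x * scaled_I \<beta> \<nu> x * B x < x * scaled_I \<beta> \<nu> x * (u x / (2 * (1 - \<beta>)))"
    using assms scaled_I_pos[OF assms(1) n, of \<beta>] by (intro mult_strict_left_mono) auto
  also have "\<dots> = 1 / (2 * (1 - \<beta>))"
    using assms scaled_I_pos[OF assms(1) n, of \<beta>] by (simp add: u_def)
  finally show ?thesis by (simp add: B_def mult.assoc)
qed

text \<open>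
For \<open>\<nu> > 1/2\<close> the tail bound applies to the order \<open>\<nu>\<close> itself, and \<open>x I\<^bsub>\<nu>\<^esub> K\<^bsub>\<nu>\<^esub> < 1/2\<close>.
\<close>

lemma scaled_integral_lt_large_order:
  assumes "0 < x" "1/2 < \<nu>" "0 < \<beta>" "\<beta> < 1"
  shows "x * (scaled_I \<beta> \<nu> x * bessel_K_integral \<beta> \<nu> \<nu> x)
    < sqrt pi * Gamma (\<nu> + 1/2) / ((1 - \<beta>\<^sup>2) powr (\<nu> + 1/2) * Gamma \<nu>)"
proof -
  define L where "L = tail_const (\<nu> - 1) \<beta>"
  have L: "0 < L" unfolding L_def using assms by (intro tail_const_pos) auto
  have "bessel_K_integral \<beta> \<nu> \<nu> x \<le> L * (exp (\<beta> * x) * (x powr \<nu> * bessel_K \<nu> x))"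
    using exp_bessel_K_tail_le[of "\<nu> - 1" \<beta> x] assms
    by (simp add: L_def bessel_K_integral_def tail_const_def mult.assoc)
  then have "x * scaled_I \<beta> \<nu> x * bessel_K_integral \<beta> \<nu> \<nu> x
      \<le> x * scaled_I \<beta> \<nu> x * (L * (exp (\<beta> * x) * (x powr \<nu> * bessel_K \<nu> x)))"
    using scaled_I_pos[of x \<nu> \<beta>] assms by (intro mult_left_mono) auto
  also have "\<dots> = L * bessel_product \<nu> x"
    using assms by (simp add: scaled_I_def bessel_product_def exp_minus field_simps)
  also have "\<dots> < L * (1/2)"
    using bessel_product_lt_half[of x \<nu>] assms L by (intro mult_strict_left_mono) auto
  also have "\<dots> < sqrt pi * Gamma (\<nu> + 1/2) / ((1 - \<beta>\<^sup>2) powr (\<nu> + 1/2) * Gamma \<nu>)"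
  proof -
    have e: "\<nu> - 1 + 3/2 = \<nu> + 1/2" "\<nu> - 1 + 1 = \<nu>" by simp_all
    have "L < 2 * sqrt pi * Gamma (\<nu> + 1/2) / ((1 - \<beta>\<^sup>2) powr (\<nu> + 1/2) * Gamma \<nu>)"
      using tail_const_less[of "\<nu> - 1" \<beta>] assms unfolding L_def e by simp
    then show ?thesis by (simp add: mult_ac)
  qed
  finally show ?thesis by (simp add: mult.assoc)
qed

section \<open>The inequalities including their limits at 0\<close>

lemma has_value_at_less:
  assumes "(f \<longlongrightarrow> l) (at_right 0)" "l < c" "\<And>x. 0 < x \<Longrightarrow> f x < c"
  shows "\<forall>x\<ge>0. \<exists>y. has_value_at f x y \<and> y < c"
proof (intro allI impI)
  fix x :: real assume "0 \<le> x"
  then show "\<exists>y. has_value_at f x y \<and> y < c"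
    using assms by (cases "x = 0") (auto simp: has_value_at_def)
qed

theorem theorem3p3:
  fixes \<beta> \<nu> :: real
  assumes "\<nu> > - 1/2"
  shows "(\<beta> < 1 \<longrightarrow> (\<forall>x>0.
        set_integrable lborel {x<..} (\<lambda>t. exp (\<beta> * t) * t powr (\<nu> + 1) * bessel_K \<nu> t) \<and>
        set_integrable lborel {x<..} (\<lambda>t. exp (\<beta> * t) * t powr \<nu> * bessel_K \<nu> t))) \<and>
      (\<beta> \<le> 0 \<longrightarrow>
        (\<forall>x\<ge>0. \<exists>y. has_value_at (\<lambda>x. exp (- \<beta> * x) * bessel_I \<nu> x / x powr \<nu> *
            (LBINT t:{x<..}. exp (\<beta> * t) * t powr (\<nu> + 1) * bessel_K \<nu> t)) x y \<and>
            (if x = 0 \<and> \<beta> = 0 then y \<le> 1 else y < 1)) \<and>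
        (\<forall>x\<ge>0. \<exists>y. has_value_at (\<lambda>x. exp (- \<beta> * x) * bessel_I (\<nu> + 1) x / x powr \<nu> *
            (LBINT t:{x<..}. exp (\<beta> * t) * t powr (\<nu> + 1) * bessel_K \<nu> t)) x y \<and>
            y < 1/2)) \<and>
      (\<beta> \<le> 0 \<longrightarrow>
        (\<forall>x\<ge>0. \<exists>y. has_value_at (\<lambda>x. exp (- \<beta> * x) * bessel_I \<nu> x / x powr (\<nu> - 1) *
            (LBINT t:{x<..}. exp (\<beta> * t) * t powr \<nu> * bessel_K \<nu> t)) x y \<and>
            y < 1) \<and>
        (\<forall>x\<ge>0. \<exists>y. has_value_at (\<lambda>x. exp (- \<beta> * x) * bessel_I (\<nu> + 1) x / x powr (\<nu> - 1) *
            (LBINT t:{x<..}. exp (\<beta> * t) * t powr \<nu> * bessel_K \<nu> t)) x y \<and>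
            y < 1/2)) \<and>
      (0 < \<beta> \<and> \<beta> < 1 \<longrightarrow>
        (\<forall>x\<ge>0. \<exists>y. has_value_at (\<lambda>x. exp (- \<beta> * x) * bessel_I \<nu> x / x powr \<nu> *
            (LBINT t:{x<..}. exp (\<beta> * t) * t powr (\<nu> + 1) * bessel_K \<nu> t)) x y \<and>
            y < 1 + 2 * sqrt pi * \<beta> * Gamma (\<nu> + 3/2) /
              ((1 - \<beta>\<^sup>2) powr (\<nu> + 3/2) * Gamma (\<nu> + 1))) \<and>
        (\<forall>x\<ge>0. \<exists>y. has_value_at (\<lambda>x. exp (- \<beta> * x) * bessel_I (\<nu> + 1) x / x powr \<nu> *
            (LBINT t:{x<..}. exp (\<beta> * t) * t powr (\<nu> + 1) * bessel_K \<nu> t)) x y \<and>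
            y < 1/2 + sqrt pi * \<beta> * Gamma (\<nu> + 3/2) /
              ((1 - \<beta>\<^sup>2) powr (\<nu> + 3/2) * Gamma (\<nu> + 1)))) \<and>
      (0 < \<beta> \<and> \<beta> < 1 \<longrightarrow>
        (\<forall>x\<ge>0. \<exists>y. has_value_at (\<lambda>x. exp (- \<beta> * x) * bessel_I \<nu> x / x powr (\<nu> - 1) *
            (LBINT t:{x<..}. exp (\<beta> * t) * t powr \<nu> * bessel_K \<nu> t)) x y \<and>
            y < bessel_N \<nu> \<beta>) \<and>
        (\<forall>x\<ge>0. \<exists>y. has_value_at (\<lambda>x. exp (- \<beta> * x) * bessel_I (\<nu> + 1) x / x powr (\<nu> - 1) *
            (LBINT t:{x<..}. exp (\<beta> * t) * t powr \<nu> * bessel_K \<nu> t)) x y \<and>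
            y < bessel_N \<nu> \<beta>))"
proof -
  have n: "\<nu> > -1/2" "\<nu> > -1" using assms by simp_all
  let ?r = "bessel_I_ratio \<nu>" and ?L = "tail_const \<nu> \<beta>"
  let ?p = "\<lambda>x. x * bessel_I \<nu> x * bessel_K (\<nu> + 1) x"
  define P where "P = (\<lambda>x. scaled_I \<beta> \<nu> x * bessel_K_integral \<beta> (\<nu> + 1) \<nu> x)"
  define Q where "Q = (\<lambda>x. x * (scaled_I \<beta> \<nu> x * bessel_K_integral \<beta> \<nu> \<nu> x))"
  let ?P = "\<lambda>x. exp (- \<beta> * x) * bessel_I \<nu> x / x powr \<nu> *
            (LBINT t:{x<..}. exp (\<beta> * t) * t powr (\<nu> + 1) * bessel_K \<nu> t)"
  let ?P' = "\<lambda>x. exp (- \<beta> * x) * bessel_I (\<nu> + 1) x / x powr \<nu> *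
            (LBINT t:{x<..}. exp (\<beta> * t) * t powr (\<nu> + 1) * bessel_K \<nu> t)"
  let ?Q = "\<lambda>x. exp (- \<beta> * x) * bessel_I \<nu> x / x powr (\<nu> - 1) *
            (LBINT t:{x<..}. exp (\<beta> * t) * t powr \<nu> * bessel_K \<nu> t)"
  let ?Q' = "\<lambda>x. exp (- \<beta> * x) * bessel_I (\<nu> + 1) x / x powr (\<nu> - 1) *
            (LBINT t:{x<..}. exp (\<beta> * t) * t powr \<nu> * bessel_K \<nu> t)"
  \<comment> \<open>The expressions with \<open>I\<^bsub>\<nu>+1\<^esub>\<close> are \<open>r\<close> times those with \<open>I\<^bsub>\<nu>\<^esub>\<close>.\<close>
  have eq: "?P x = P x" "?P' x = ?r x * P x" "?Q x = Q x" "?Q' x = ?r x * Q x" if "0 < x" for x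
    using that bessel_I_Suc[OF that n(2)]
    by (simp_all add: P_def Q_def scaled_I_def bessel_K_integral_def powr_diff)
  have tends: "(f \<longlongrightarrow> l) (at_right 0)" if "(g \<longlongrightarrow> l) (at_right 0)" "\<And>x. 0 < x \<Longrightarrow> f x = g x"
    for f g :: "real \<Rightarrow> real" and l
    by (rule Lim_transform_eventually[OF that(1)])
      (use that(2) eventually_at_right_less[of "0::real"] in \<open>auto elim!: eventually_mono\<close>)
  have Q_le: "Q x \<le> P x" if "0 < x" "\<beta> < 1" for x
    using mult_left_mono[OF bessel_K_integral_weight_mono[OF that(1) n(1) that(2)], of "scaled_I \<beta> \<nu> x"]
      scaled_I_pos[OF that(1) n(2), of \<beta>] by (simp add: P_def Q_def mult_ac)
  have Q_pos: "0 < Q x" if "0 < x" "\<beta> < 1" for x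
    unfolding Q_def using that n
    by (intro mult_pos_pos scaled_I_pos bessel_K_integral_pos bessel_K_weighted_integrable) auto
  have r_p: "?r x * ?p x < 1/2" "?p x < 1" "0 < ?p x" "0 < ?r x" "?r x < 1" if "0 < x" for x
  proof -
    show "?r x * ?p x < 1/2"
      using bessel_product_lt_half[OF that, of "\<nu> + 1"] n bessel_I_Suc[OF that n(2)]
      by (simp add: bessel_product_def mult_ac)
    show "?p x < 1" by (rule bessel_cross_product_lt_1[OF that n(1)])
    show "0 < ?p x" using that n by (simp add: bessel_I_pos bessel_K_pos)
  qed (use bessel_I_ratio_pos[OF that n(2)] bessel_I_ratio_lt_1[OF that n(1)] in auto)
  have limP: "(P \<longlongrightarrow> 1 + \<beta> * ?L) (at_right 0)" if "\<beta> < 1"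
    unfolding P_def using scaled_integral_at_right_0[OF n(1) that] .
  have limQ: "(Q \<longlongrightarrow> 0) (at_right 0)" if "\<beta> < 1"
  proof -
    have "(Q \<longlongrightarrow> 0 * (1 / (2 powr \<nu> * Gamma (\<nu> + 1)) * bessel_K_integral \<beta> \<nu> \<nu> 0)) (at_right 0)"
      unfolding Q_def using n that
      by (intro tendsto_mult tendsto_ident_at scaled_I_at_right_0 bessel_K_integral_tendsto bessel_K_weighted_integrable) auto
    then show ?thesis by simp
  qed
  have limr: "((\<lambda>x. ?r x * f x) \<longlongrightarrow> 0) (at_right 0)" if "(f \<longlongrightarrow> l) (at_right 0)" for f l
    using tendsto_mult[OF bessel_I_ratio_at_right_0[OF n(2)] that] by simp
  have integrable: "set_integrable lborel {x<..} (\<lambda>t. exp (\<beta> * t) * t powr (\<nu> + 1) * bessel_K \<nu> t)"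
      "set_integrable lborel {x<..} (\<lambda>t. exp (\<beta> * t) * t powr \<nu> * bessel_K \<nu> t)" if "\<beta> < 1" "0 < x" for x
    by (rule set_integrable_subset[OF bessel_K_weighted_integrable(2)[OF n(1) that(1)]]
          set_integrable_subset[OF bessel_K_weighted_integrable(1)[OF n(1) that(1)]]; use that in auto)+
  have neg: "P x < 1" "?r x * P x < 1/2" if "\<beta> \<le> 0" "0 < x" for x
  proof -
    have le: "P x \<le> ?p x"
      unfolding P_def by (rule scaled_integral_le_nonpos[OF that(2) n(1) that(1)])
    then show "P x < 1" using r_p(2)[OF that(2)] by linarith
    have "?r x * P x \<le> ?r x * ?p x" using le r_p(4)[OF that(2)] by (intro mult_left_mono) auto
    then show "?r x * P x < 1/2" using r_p(1)[OF that(2)] by linarith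
  qed
  have pos: "P x < 1 + \<beta> * C" "?r x * P x < 1/2 + \<beta> * C / 2"
    if "0 < \<beta>" "\<beta> < 1" "0 < x" "?L < C" for x C
  proof -
    have L: "0 < ?L" using tail_const_pos[OF n(1) that(2)] .
    have LC: "\<beta> * ?L < \<beta> * C" using that by simp
    have le: "P x \<le> (1 + \<beta> * ?L) * ?p x"
      unfolding P_def by (rule scaled_integral_le_pos[OF that(3) n(1) that(1,2)])
    have "0 < 1 + \<beta> * ?L" using L that by (intro add_pos_pos mult_pos_pos) auto
    then have "(1 + \<beta> * ?L) * ?p x < (1 + \<beta> * ?L) * 1" "(1 + \<beta> * ?L) * (?r x * ?p x) < (1 + \<beta> * ?L) * (1/2)"
      using r_p(1,2)[OF that(3)] by (intro mult_strict_left_mono; simp)+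
    moreover have "?r x * P x \<le> ?r x * ((1 + \<beta> * ?L) * ?p x)"
      using le r_p(4)[OF that(3)] by (intro mult_left_mono) auto
    ultimately show "P x < 1 + \<beta> * C" "?r x * P x < 1/2 + \<beta> * C / 2"
      using le LC by (simp_all add: mult.left_commute)
  qed
  have N: "Q x < bessel_N \<nu> \<beta>" if "0 < \<beta>" "\<beta> < 1" "0 < x" for x
  proof (cases "\<nu> \<le> 1/2")
    case True
    then show ?thesis
      using scaled_integral_lt_small_order[OF that(3) n(1) True, of \<beta>] that by (simp add: Q_def bessel_N_def)
  next
    case False
    then show ?thesis
      using scaled_integral_lt_large_order[OF that(3) _ that(1,2), of \<nu>] by (simp add: Q_def bessel_N_def)
  qed
  have N': "?r x * Q x < bessel_N \<nu> \<beta>" if "0 < \<beta>" "\<beta> < 1" "0 < x" for x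
  proof -
    have "?r x * Q x < 1 * Q x"
      using r_p(5)[OF that(3)] Q_pos[OF that(3,2)] by (intro mult_strict_right_mono)
    then show ?thesis using N[OF that] by simp
  qed
  have N_pos: "0 < bessel_N \<nu> \<beta>" if "0 < \<beta>" "\<beta> < 1"
    using N[OF that, of 1] Q_pos[of 1] that by simp
  have part_i: "\<forall>x\<ge>0. \<exists>y. has_value_at ?P x y \<and> (if x = 0 \<and> \<beta> = 0 then y \<le> 1 else y < 1)" if "\<beta> \<le> 0"
  proof (intro allI impI)
    fix x :: real assume x: "0 \<le> x"
    show "\<exists>y. has_value_at ?P x y \<and> (if x = 0 \<and> \<beta> = 0 then y \<le> 1 else y < 1)"
    proof (cases "x = 0")
      case True
      have "has_value_at ?P x (1 + \<beta> * ?L)"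
        using tends[OF limP eq(1)] that True by (simp add: has_value_at_def)
      moreover have "\<beta> * ?L < 0" if "\<beta> \<noteq> 0"
        using that \<open>\<beta> \<le> 0\<close> tail_const_pos[OF n(1), of \<beta>] by (intro mult_neg_pos) auto
      ultimately show ?thesis by (intro exI[of _ "1 + \<beta> * ?L"]) (auto simp: True)
    next
      case False
      then have x: "0 < x" using x by simp
      have "has_value_at ?P x (?P x)" using x by (simp add: has_value_at_def)
      moreover have "?P x < 1" unfolding eq(1)[OF x] by (rule neg(1)[OF that x])
      ultimately show ?thesis using False by (intro exI[of _ "?P x"] conjI) simp_all
    qed
  qed
  have part_i': "\<forall>x\<ge>0. \<exists>y. has_value_at ?P' x y \<and> y < 1/2" if "\<beta> \<le> 0"
  proof (rule has_value_at_less[OF tends[OF limr[OF limP] eq(2)]])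
    show "?P' x < 1/2" if "0 < x" for x
      unfolding eq(2)[OF that] by (rule neg(2)[OF \<open>\<beta> \<le> 0\<close> that])
  qed (use that in auto)
  have part_ii: "\<forall>x\<ge>0. \<exists>y. has_value_at ?Q x y \<and> y < 1" if "\<beta> \<le> 0"
  proof (rule has_value_at_less[OF tends[OF limQ eq(3)]])
    fix x :: real assume x: "0 < x"
    show "?Q x < 1" unfolding eq(3)[OF x] using Q_le[OF x] neg(1)[OF that x] that by linarith
  qed (use that in auto)
  have part_ii': "\<forall>x\<ge>0. \<exists>y. has_value_at ?Q' x y \<and> y < 1/2" if "\<beta> \<le> 0"
  proof (rule has_value_at_less[OF tends[OF limr[OF limQ] eq(4)]])
    fix x :: real assume x: "0 < x"
    have "?r x * Q x \<le> ?r x * P x"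
      using Q_le[OF x] r_p(4)[OF x] that by (intro mult_left_mono) auto
    then show "?Q' x < 1/2" unfolding eq(4)[OF x] using neg(2)[OF that x] by linarith
  qed (use that in auto)
  have part_iii: "\<forall>x\<ge>0. \<exists>y. has_value_at ?P x y \<and> y < 1 + 2 * sqrt pi * \<beta> * Gamma (\<nu> + 3/2) /
              ((1 - \<beta>\<^sup>2) powr (\<nu> + 3/2) * Gamma (\<nu> + 1))"
      "\<forall>x\<ge>0. \<exists>y. has_value_at ?P' x y \<and> y < 1/2 + sqrt pi * \<beta> * Gamma (\<nu> + 3/2) /
              ((1 - \<beta>\<^sup>2) powr (\<nu> + 3/2) * Gamma (\<nu> + 1))" if \<beta>: "0 < \<beta>" "\<beta> < 1"
  proof -
    define C where "C = 2 * sqrt pi * Gamma (\<nu> + 3/2) / ((1 - \<beta>\<^sup>2) powr (\<nu> + 3/2) * Gamma (\<nu> + 1))"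
    have C: "?L < C" unfolding C_def by (rule tail_const_less[OF n(1) \<beta>])
    have LC: "\<beta> * ?L < \<beta> * C" using C \<beta> by simp
    have C0: "0 < \<beta> * C" using C \<beta> tail_const_pos[OF n(1) \<beta>(2)] by simp
    have c: "1 + 2 * sqrt pi * \<beta> * Gamma (\<nu> + 3/2) / ((1 - \<beta>\<^sup>2) powr (\<nu> + 3/2) * Gamma (\<nu> + 1)) = 1 + \<beta> * C"
      "1/2 + sqrt pi * \<beta> * Gamma (\<nu> + 3/2) / ((1 - \<beta>\<^sup>2) powr (\<nu> + 3/2) * Gamma (\<nu> + 1)) = 1/2 + \<beta> * C / 2"
      by (simp_all add: C_def)
    show "\<forall>x\<ge>0. \<exists>y. has_value_at ?P x y \<and> y < 1 + 2 * sqrt pi * \<beta> * Gamma (\<nu> + 3/2) /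
              ((1 - \<beta>\<^sup>2) powr (\<nu> + 3/2) * Gamma (\<nu> + 1))"
      unfolding c
    proof (rule has_value_at_less[OF tends[OF limP[OF \<beta>(2)] eq(1)]])
      show "?P x < 1 + \<beta> * C" if "0 < x" for x
        unfolding eq(1)[OF that] by (rule pos(1)[OF \<beta> that C])
    qed (use LC in auto)
    show "\<forall>x\<ge>0. \<exists>y. has_value_at ?P' x y \<and> y < 1/2 + sqrt pi * \<beta> * Gamma (\<nu> + 3/2) /
              ((1 - \<beta>\<^sup>2) powr (\<nu> + 3/2) * Gamma (\<nu> + 1))"
      unfolding c
    proof (rule has_value_at_less[OF tends[OF limr[OF limP[OF \<beta>(2)]] eq(2)]])
      show "?P' x < 1/2 + \<beta> * C / 2" if "0 < x" for x
        unfolding eq(2)[OF that] by (rule pos(2)[OF \<beta> that C])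
    qed (use C0 in auto)
  qed
  have part_iv: "\<forall>x\<ge>0. \<exists>y. has_value_at ?Q x y \<and> y < bessel_N \<nu> \<beta>"
      "\<forall>x\<ge>0. \<exists>y. has_value_at ?Q' x y \<and> y < bessel_N \<nu> \<beta>" if \<beta>: "0 < \<beta>" "\<beta> < 1"
  proof -
    show "\<forall>x\<ge>0. \<exists>y. has_value_at ?Q x y \<and> y < bessel_N \<nu> \<beta>"
    proof (rule has_value_at_less[OF tends[OF limQ[OF \<beta>(2)] eq(3)] N_pos[OF \<beta>]])
      show "?Q x < bessel_N \<nu> \<beta>" if "0 < x" for x
        unfolding eq(3)[OF that] by (rule N[OF \<beta> that])
    qed
    show "\<forall>x\<ge>0. \<exists>y. has_value_at ?Q' x y \<and> y < bessel_N \<nu> \<beta>"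
    proof (rule has_value_at_less[OF tends[OF limr[OF limQ[OF \<beta>(2)]] eq(4)] N_pos[OF \<beta>]])
      show "?Q' x < bessel_N \<nu> \<beta>" if "0 < x" for x
        unfolding eq(4)[OF that] by (rule N'[OF \<beta> that])
    qed
  qed
  show ?thesis
    using integrable part_i part_i' part_ii part_ii' part_iii part_iv by simp
qed

end
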